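(* Let $m\ge 1$ and let $F(x_1,\dots,x_m)$ be a linear combination of Schur polynomials $s_\mu(x_1,\dots,x_m)$ of partitions $\mu$ with at most $m$ parts. Suppose that $F$ satisfies the two conditions (a), (b) in the definition of a good linear combination, except that (a) is replaced by (a') below, or (b) is replaced by (b') below (or both replacements are made): (a') any two Schur polynomials in the same bracket of $F$ have coefficients of the same sign; (b') there exist partitions $\bar\lambda\le\hat\lambda$ with at most $m$ parts such that $s_\mu$ appears in $F$ if and only if $\bar\lambda\le\mu\le\hat\lambda$. Then $F$ is good. In particular, $F$ has saturated Newton polytope (SNP), and $Newton(F)$ has the integer decomposition property (IDP).
   Context: **Polytopes.** A lattice polytope in $\mathbb{R}^m$ is the convex hull of finitely many points whose vertices lie in $\mathbb{Z}^m$. For a positive integer $t$, $t\mathcal{P}=\{tv \mid v\in\mathcal{P}\}$. A lattice polytope $\mathcal{P}$ has the integer decomposition property (IDP) if for every positive integer $t$ and every $p\in t\mathcal{P}\cap\mathbb{Z}^m$ there are $t$ points $v_1,\dots,v_t\in\mathcal{P}\cap\mathbb{Z}^m$ (not necessarily distinct) with $p=v_1+\dots+v_t$. **Newton polytopes.** For $f=\sum_{\alpha\in\mathbb{Z}_{\ge 0}^m}c_\alpha x^\alpha\in\mathbb{C}[x_1,\dots,x_m]$, let $Supp(f)=\{\alpha\in\mathbb{Z}_{\ge0}^m \mid c_\alpha\neq 0\}$ and let $Newton(f)=Conv(Supp(f))$ be its convex hull in $\mathbb{R}^m$. The polynomial $f$ has saturated Newton polytope (SNP) if $Newton(f)\cap\mathbb{Z}^m=Supp(f)$.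 **Partitions and Schur polynomials.** A partition with at most $m$ parts is a weakly decreasing sequence $\lambda=(\lambda_1,\dots,\lambda_m)$ of nonnegative integers; its size is $|\lambda|=\sum_i\lambda_i$. It is identified with its Young diagram, which has $\lambda_i$ boxes, left-justified, in the $i$-th row from the top. The Schur polynomial $s_\lambda(x_1,\dots,x_m)$ is the sum of $x^T=x_1^{\alpha_1}\cdots x_m^{\alpha_m}$ over all semistandard Young tableaux $T$ of shape $\lambda$ with entries in $\{1,\dots,m\}$ (rows weakly increasing, columns strictly increasing from top to bottom), where $\alpha_i$ is the number of entries $i$ in $T$. **Orders.** For partitions with at most $m$ parts, $\beta\ge\alpha$ means $\beta_i\ge\alpha_i$ for all $i$ (and $\beta>\alpha$ means in addition $\beta\ne\alpha$). If $|\alpha|=|\beta|$, then $\beta\trianglerighteq\alpha$ ($\beta$ dominates $\alpha$) means $\sum_{i=1}^j\beta_i\ge\sum_{i=1}^j\alpha_i$ for all $j\ge1$. **Good linear combinations.** Let $F=\sum_\mu C_\mu s_\mu(x_1,\dots,x_m)$ be a linear combination of Schur polynomials of partitions with at most $m$ parts; $s_\mu$ appears in $F$ if $C_\mu\ne0$. For each size $d$ for which some $s_\mu$ with $|\mu|=d$ appears in $F$, the corresponding bracket of $F$ is the sum $\sum_{|\mu|=d}C_\mu s_\mu$, and its Schur elements are the $s_\mu$ with $|\mu|=d$ and $C_\mu\neq0$. In (a'), having the same sign means that the nonzero coefficients $C_\mu$ in a bracket are real and are all positive or all negative. $F$ is called good if: (a) the support of each bracket equals the union of the supports of its Schur elements;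 (b) let $l+1$ be the number of brackets of $F$. Among the partitions indexing the Schur elements of each bracket there is a unique $\trianglerighteq$-maximum partition (one which dominates all the others of that bracket), and these maximum partitions form a chain $\alpha=\lambda^0<\lambda^1<\dots<\lambda^l=\beta$, where $\alpha\le\beta$ are fixed partitions and, for each $i>0$, $\lambda^i$ is obtained from $\lambda^{i-1}$ by adding one box in the northmost (topmost) row of $\lambda^{i-1}$ such that the addition gives a Young diagram with $\alpha<\lambda^i\le\beta$. *)

theory Defs
  imports "HOL-Analysis.Analysis" "HOL-Library.Poly_Mapping" "HOL-Library.FuncSet"
begin

text \<open>
  Throughout, the index type \<open>'m\<close> of class \<open>{finite, linorder}\<close> plays the role of \<open>{1 < ... < m}\<close>:
  it indexes the variables, the coordinates of the ambient space, the parts of a partition, the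
  rows of a Young diagram (smaller is further north) and the possible entries of a tableau.
\<close>

section \<open>Lattice polytopes\<close>

definition int_lattice :: "(real ^ 'm) set" where
  "int_lattice = {x. \<forall>i. x $ i \<in> \<int>}"

definition lattice_polytope :: "(real ^ 'm) set \<Rightarrow> bool" where
  "lattice_polytope P \<longleftrightarrow> polytope P \<and> (\<forall>v. v extreme_point_of P \<longrightarrow> v \<in> int_lattice)"

definition IDP :: "(real ^ 'm) set \<Rightarrow> bool" where
  "IDP P \<longleftrightarrow> lattice_polytope P \<and>
     (\<forall>t::nat. \<forall>p. t > 0 \<and> p \<in> (\<lambda>v. real t *\<^sub>R v) ` P \<inter> int_lattice \<longrightarrow>
        (\<exists>v :: nat \<Rightarrow> real ^ 'm. (\<forall>k\<in>{1..t}. v k \<in> P \<inter> int_lattice) \<and> p = (\<Sum>k=1..t. v k)))"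

section \<open>Polynomials and Newton polytopes\<close>

text \<open>A polynomial maps exponent vectors to coefficients; its multiplication is the convolution
  product on \<^type>\<open>poly_mapping\<close>.\<close>

type_synonym 'm mpoly = "('m \<Rightarrow>\<^sub>0 nat) \<Rightarrow>\<^sub>0 complex"

definition var :: "'m \<Rightarrow> 'm mpoly" where
  "var i = Poly_Mapping.single (Poly_Mapping.single i 1) 1"

definition const :: "complex \<Rightarrow> 'm mpoly" where
  "const c = Poly_Mapping.single 0 c"

definition Supp :: "'m::finite mpoly \<Rightarrow> (real ^ 'm) set" where
  "Supp f = (\<lambda>a. \<chi> i. real (Poly_Mapping.lookup a i)) ` Poly_Mapping.keys f"

definition Newton :: "'m::finite mpoly \<Rightarrow> (real ^ 'm) set" where
  "Newton f = convex hull (Supp f)"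

definition SNP :: "'m::finite mpoly \<Rightarrow> bool" where
  "SNP f \<longleftrightarrow> Newton f \<inter> int_lattice = Supp f"

section \<open>Partitions and Schur polynomials\<close>

text \<open>The order \<open>\<alpha> \<le> \<beta>\<close> on partitions is the pointwise order on functions.\<close>

definition is_partition :: "('m::{finite,linorder} \<Rightarrow> nat) \<Rightarrow> bool" where
  "is_partition \<mu> \<longleftrightarrow> (\<forall>i j. i \<le> j \<longrightarrow> \<mu> j \<le> \<mu> i)"

definition psize :: "('m::{finite,linorder} \<Rightarrow> nat) \<Rightarrow> nat" where
  "psize \<mu> = (\<Sum>i\<in>UNIV. \<mu> i)"

definition dominates :: "('m::{finite,linorder} \<Rightarrow> nat) \<Rightarrow> ('m \<Rightarrow> nat) \<Rightarrow> bool"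
    (infix "\<unrhd>" 50) where
  "\<beta> \<unrhd> \<alpha> \<longleftrightarrow> psize \<beta> = psize \<alpha> \<and> (\<forall>j. (\<Sum>i\<in>{..j}. \<alpha> i) \<le> (\<Sum>i\<in>{..j}. \<beta> i))"

text \<open>Boxes are pairs (row, column), with columns numbered from 0.\<close>

definition diagram :: "('m::{finite,linorder} \<Rightarrow> nat) \<Rightarrow> ('m \<times> nat) set" where
  "diagram \<mu> = {(i, j). j < \<mu> i}"

text \<open>Tableaux are extensional functions on the diagram, so that distinct elements of
  \<open>SSYT \<mu>\<close> are distinct fillings and \<open>SSYT \<mu>\<close> is finite.\<close>

definition SSYT :: "('m::{finite,linorder} \<Rightarrow> nat) \<Rightarrow> ('m \<times> nat \<Rightarrow> 'm) set" where
  "SSYT \<mu> = {T \<in> diagram \<mu> \<rightarrow>\<^sub>E UNIV.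
     (\<forall>i j j'. j < j' \<and> (i, j) \<in> diagram \<mu> \<and> (i, j') \<in> diagram \<mu> \<longrightarrow> T (i, j) \<le> T (i, j')) \<and>
     (\<forall>i i' j. i < i' \<and> (i, j) \<in> diagram \<mu> \<and> (i', j) \<in> diagram \<mu> \<longrightarrow> T (i, j) < T (i', j))}"

lemma finite_diagram: "finite (diagram \<mu>)"
proof -
  have "diagram \<mu> = (SIGMA i:UNIV. {..<\<mu> i})"
    by (auto simp: diagram_def)
  then show ?thesis by simp
qed

lemma finite_SSYT: "finite (SSYT \<mu>)"
proof -
  have "finite (diagram \<mu> \<rightarrow>\<^sub>E (UNIV :: 'a set))"
    by (intro finite_PiE finite_diagram) simp
  then show ?thesis
    by (rule finite_subset[rotated]) (auto simp: SSYT_def)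
qed

definition schur :: "('m::{finite,linorder} \<Rightarrow> nat) \<Rightarrow> 'm mpoly" where
  "schur \<mu> = (\<Sum>T\<in>SSYT \<mu>. \<Prod>i\<in>UNIV. var i ^ card {c \<in> diagram \<mu>. T c = i})"

section \<open>Good linear combinations of Schur polynomials\<close>

text \<open>A linear combination is given by its finitely supported family \<open>C\<close> of coefficients;
  \<open>s\<^sub>\<mu>\<close> appears in it iff \<open>\<mu> \<in> keys C\<close>.\<close>

type_synonym 'm schur_coeffs = "('m \<Rightarrow> nat) \<Rightarrow>\<^sub>0 complex"

definition schur_comb :: "'m::{finite,linorder} schur_coeffs \<Rightarrow> 'm mpoly" where
  "schur_comb C = (\<Sum>\<mu>\<in>Poly_Mapping.keys C. const (Poly_Mapping.lookup C \<mu>) * schur \<mu>)"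

definition bracket_sizes :: "'m::{finite,linorder} schur_coeffs \<Rightarrow> nat set" where
  "bracket_sizes C = psize ` Poly_Mapping.keys C"

definition bracket_parts :: "'m::{finite,linorder} schur_coeffs \<Rightarrow> nat \<Rightarrow> ('m \<Rightarrow> nat) set" where
  "bracket_parts C d = {\<mu> \<in> Poly_Mapping.keys C. psize \<mu> = d}"

definition bracket :: "'m::{finite,linorder} schur_coeffs \<Rightarrow> nat \<Rightarrow> 'm mpoly" where
  "bracket C d = (\<Sum>\<mu>\<in>bracket_parts C d. const (Poly_Mapping.lookup C \<mu>) * schur \<mu>)"

definition cond_a :: "'m::{finite,linorder} schur_coeffs \<Rightarrow> bool" where
  "cond_a C \<longleftrightarrow> (\<forall>d\<in>bracket_sizes C. Supp (bracket C d) = (\<Union>\<mu>\<in>bracket_parts C d. Supp (schur \<mu>)))"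

definition is_max_part :: "'m::{finite,linorder} schur_coeffs \<Rightarrow> nat \<Rightarrow> ('m \<Rightarrow> nat) \<Rightarrow> bool" where
  "is_max_part C d \<mu> \<longleftrightarrow> \<mu> \<in> bracket_parts C d \<and> (\<forall>\<nu>\<in>bracket_parts C d. \<mu> \<unrhd> \<nu>)"

definition add_box :: "('m::{finite,linorder} \<Rightarrow> nat) \<Rightarrow> 'm \<Rightarrow> ('m \<Rightarrow> nat)" where
  "add_box \<mu> r = \<mu>(r := Suc (\<mu> r))"

definition admissible_row ::
    "('m::{finite,linorder} \<Rightarrow> nat) \<Rightarrow> ('m \<Rightarrow> nat) \<Rightarrow> ('m \<Rightarrow> nat) \<Rightarrow> 'm \<Rightarrow> bool" where
  "admissible_row \<alpha> \<beta> \<mu> r \<longleftrightarrow>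
     is_partition (add_box \<mu> r) \<and> \<alpha> < add_box \<mu> r \<and> add_box \<mu> r \<le> \<beta>"

definition northmost_step ::
    "('m::{finite,linorder} \<Rightarrow> nat) \<Rightarrow> ('m \<Rightarrow> nat) \<Rightarrow> ('m \<Rightarrow> nat) \<Rightarrow> ('m \<Rightarrow> nat) \<Rightarrow> bool" where
  "northmost_step \<alpha> \<beta> \<mu> \<nu> \<longleftrightarrow>
     (\<exists>r. admissible_row \<alpha> \<beta> \<mu> r \<and> (\<forall>r'<r. \<not> admissible_row \<alpha> \<beta> \<mu> r') \<and> \<nu> = add_box \<mu> r)"

definition cond_b :: "'m::{finite,linorder} schur_coeffs \<Rightarrow> bool" where
  "cond_b C \<longleftrightarrow>
     (\<forall>d\<in>bracket_sizes C. \<exists>!\<mu>. is_max_part C d \<mu>) \<and>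
     (\<exists>\<alpha> \<beta> l (\<Lambda> :: nat \<Rightarrow> 'm \<Rightarrow> nat).
        is_partition \<alpha> \<and> is_partition \<beta> \<and> \<alpha> \<le> \<beta> \<and>
        card (bracket_sizes C) = l + 1 \<and>
        {\<mu>. \<exists>d\<in>bracket_sizes C. is_max_part C d \<mu>} = \<Lambda> ` {0..l} \<and>
        \<Lambda> 0 = \<alpha> \<and> \<Lambda> l = \<beta> \<and>
        (\<forall>i\<in>{1..l}. \<Lambda> (i - 1) < \<Lambda> i \<and> northmost_step \<alpha> \<beta> (\<Lambda> (i - 1)) (\<Lambda> i)))"

definition good :: "'m::{finite,linorder} schur_coeffs \<Rightarrow> bool" where
  "good C \<longleftrightarrow> cond_a C \<and> cond_b C"

definition cond_a' :: "'m::{finite,linorder} schur_coeffs \<Rightarrow> bool" where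
  "cond_a' C \<longleftrightarrow> (\<forall>d\<in>bracket_sizes C.
     (\<forall>\<mu>\<in>bracket_parts C d. \<exists>x::real. x > 0 \<and> Poly_Mapping.lookup C \<mu> = of_real x) \<or>
     (\<forall>\<mu>\<in>bracket_parts C d. \<exists>x::real. x < 0 \<and> Poly_Mapping.lookup C \<mu> = of_real x))"

definition cond_b' :: "'m::{finite,linorder} schur_coeffs \<Rightarrow> bool" where
  "cond_b' C \<longleftrightarrow> (\<exists>lo hi. is_partition lo \<and> is_partition hi \<and> lo \<le> hi \<and>
     (\<forall>\<mu>. is_partition \<mu> \<longrightarrow> (\<mu> \<in> Poly_Mapping.keys C \<longleftrightarrow> lo \<le> \<mu> \<and> \<mu> \<le> hi)))"

end

theory Submission
  imports Defs
begin

text \<open>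
  Let \<open>\<alpha> \<le> \<beta>\<close> be the first and the last partition of the chain of dominance-maximal partitions of a
  good combination \<open>F\<close>, and let \<open>m\<close> be the number of variables. Everything is controlled by one
  polytope \<open>Q(\<alpha>, \<beta>)\<close> (\<open>subset_sum_polytope\<close>): the \<open>x \<in> \<real>\<^sup>m\<close> such that, for every set \<open>S\<close> of
  coordinates, \<open>\<Sum>\<^sub>i\<^sub>\<in>\<^sub>S x\<^sub>i\<close> is at least the sum of the \<open>|S|\<close> smallest parts of \<open>\<alpha>\<close> and at most
  the sum of the \<open>|S|\<close> largest parts of \<open>\<beta>\<close>. The main claim (\<open>Supp_good\<close>) is that the support of
  \<open>F\<close> is exactly the set of lattice points of \<open>Q(\<alpha>, \<beta>)\<close>.

  The reason is that always adding the northmost box fills the rows of \<open>\<beta>\<close> one after the other, so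
  every partition in the chain agrees with \<open>\<beta>\<close> above some row and with \<open>\<alpha>\<close> below it
  (\<open>greedy\<close>). Hence each of its initial sums is as large as the bounds \<open>\<alpha>\<close> and \<open>\<beta>\<close> and its size
  permit (\<open>greedy_top_or_tail\<close>), and the bounds that define \<open>Q(\<alpha>, \<beta>)\<close>, restricted to vectors
  of size \<open>d\<close>, become the bounds \<open>\<Sum>\<^sub>i\<^sub>\<in>\<^sub>S a\<^sub>i \<le> \<nu>\<^sub>1 + \<dots> + \<nu>\<^sub>|\<^sub>S\<^sub>|\<close> for the greedy partition \<open>\<nu>\<close> of size
  \<open>d\<close>. By the theorem that describes the support of a Schur polynomial, these bounds characterise
  the contents \<open>a\<close> of semistandard tableaux of shape \<open>\<nu>\<close>: they are necessary by counting entries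
  column by column (\<open>sum_content_le_top_sum\<close>) and sufficient by peeling off the boxes with the
  largest letter as a horizontal strip (\<open>tableau_exists\<close>). The strip is again chosen greedily,
  between the diagram without its first row and the diagram without its last row, so the same lemma
  on greedy partitions does the work.

  Since \<open>Q(\<alpha>, \<beta>)\<close> is convex, saturation follows at once. For the integer decomposition property, a
  lattice point of \<open>t Q(\<alpha>, \<beta>)\<close> lies in \<open>Q(t\<alpha>, t\<beta>)\<close>, so it is the content of a tableau whose
  shape is between \<open>t\<alpha>\<close> and \<open>t\<beta>\<close>. Distributing the columns of this tableau cyclically among \<open>t\<close>
  tableaux gives \<open>t\<close> shapes between \<open>\<alpha>\<close> and \<open>\<beta>\<close>, whose contents are lattice points of
  \<open>Q(\<alpha>, \<beta>)\<close> and add up to the given point (\<open>scaled_lattice_point_decomposes\<close>).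

  It remains to see that the hypotheses imply goodness. Coefficients of the same sign cannot cancel,
  because Schur polynomials have nonnegative coefficients. If the partitions that appear form an
  interval, the greedy chain from its bottom to its top consists of the maxima of its brackets
  (\<open>greedy_dominates\<close>).
\<close>

section \<open>Initial and final sums of partitions\<close>

text \<open>
  Rows are elements of an abstract finite linear order; their positions, counted from 0, allow sums
  over the first \<open>k\<close> rows to be compared with sums over arbitrary sets of \<open>k\<close> coordinates.
\<close>

definition row_index :: "'m::{finite,linorder} \<Rightarrow> nat" where
  "row_index i = card {..<i}"

definition top_sum :: "('m::{finite,linorder} \<Rightarrow> nat) \<Rightarrow> nat \<Rightarrow> nat" where
  "top_sum \<mu> k = (\<Sum>i | row_index i < k. \<mu> i)"

definition tail_sum :: "('m::{finite,linorder} \<Rightarrow> nat) \<Rightarrow> nat \<Rightarrow> nat" where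
  "tail_sum \<mu> k = (\<Sum>i | k \<le> row_index i. \<mu> i)"

lemma row_index_less_iff [simp]: "row_index i < row_index j \<longleftrightarrow> i < j"
proof -
  have mono: "row_index a < row_index b" if "a < b" for a b :: 'a
    unfolding row_index_def by (rule psubset_card_mono) (use that in auto)
  show ?thesis
    using mono[of i j] mono[of j i] by (metis less_asym linorder_less_linear)
qed

lemma row_index_le_iff [simp]: "row_index i \<le> row_index j \<longleftrightarrow> i \<le> j"
  by (meson linorder_not_less row_index_less_iff)

lemma row_index_eq_iff [simp]: "row_index i = row_index j \<longleftrightarrow> i = j"
  by (metis antisym order_refl row_index_le_iff)

lemma row_index_less_CARD: "row_index (i :: 'm::{finite,linorder}) < CARD('m)"
  unfolding row_index_def by (rule psubset_card_mono) auto

lemma range_row_index: "range (row_index :: 'm::{finite,linorder} \<Rightarrow> nat) = {..<CARD('m)}"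
proof (rule card_subset_eq)
  show "card (range (row_index :: 'm \<Rightarrow> nat)) = card {..<CARD('m)}"
    by (simp add: card_image inj_on_def)
qed (auto simp: row_index_less_CARD)

lemma obtain_row:
  assumes "k < CARD('m::{finite,linorder})"
  obtains i :: "'m::{finite,linorder}" where "row_index i = k"
  using assms range_row_index[where 'm = 'm] by (metis imageE lessThan_iff)

lemma card_row_index_less:
  assumes "k \<le> CARD('m::{finite,linorder})"
  shows "card {i :: 'm::{finite,linorder}. row_index i < k} = k"
proof -
  have "row_index ` {i :: 'm. row_index i < k} = {..<k}"
    using assms range_row_index[where 'm = 'm] by (auto simp: set_eq_iff image_iff) (metis order_less_le_trans)
  moreover have "inj_on row_index {i :: 'm. row_index i < k}"
    by (simp add: inj_on_def)
  ultimately show ?thesis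
    by (metis card_image card_lessThan)
qed

lemma top_plus_tail: "top_sum \<mu> k + tail_sum \<mu> k = psize \<mu>"
proof -
  have "psize \<mu> = sum \<mu> ({i. row_index i < k} \<union> {i. k \<le> row_index i})"
    unfolding psize_def by (rule sum.cong) auto
  also have "\<dots> = top_sum \<mu> k + tail_sum \<mu> k"
    unfolding top_sum_def tail_sum_def by (rule sum.union_disjoint) auto
  finally show ?thesis by simp
qed

lemma tail_sum_0: "tail_sum \<mu> 0 = psize \<mu>"
  by (simp add: tail_sum_def psize_def)

lemma top_sum_CARD: "top_sum (\<mu> :: 'm::{finite,linorder} \<Rightarrow> nat) CARD('m) = psize \<mu>"
  by (simp add: top_sum_def psize_def row_index_less_CARD)

lemma top_sum_mono: "\<mu> \<le> \<nu> \<Longrightarrow> top_sum \<mu> k \<le> top_sum \<nu> k"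
  by (auto simp: top_sum_def le_fun_def intro: sum_mono)

lemma tail_sum_mono: "\<mu> \<le> \<nu> \<Longrightarrow> tail_sum \<mu> k \<le> tail_sum \<nu> k"
  by (auto simp: tail_sum_def le_fun_def intro: sum_mono)

lemma top_sum_mono_index: "k \<le> k' \<Longrightarrow> top_sum \<mu> k \<le> top_sum \<mu> k'"
  unfolding top_sum_def by (rule sum_mono2) auto

lemma psize_mono: "\<mu> \<le> \<nu> \<Longrightarrow> psize \<mu> \<le> psize \<nu>"
  by (auto simp: psize_def le_fun_def intro: sum_mono)

lemma psize_le_imp_eq:
  assumes "\<mu> \<le> \<nu>" "psize \<nu> \<le> psize \<mu>"
  shows "\<mu> = \<nu>"
proof
  fix i
  have "psize \<mu> = psize \<nu>"
    using assms psize_mono by (metis le_antisym)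
  then show "\<mu> i = \<nu> i"
    using sum_mono_inv[of \<mu> UNIV \<nu> i] assms(1) by (auto simp: psize_def le_fun_def)
qed

lemma top_sum_Suc_row_index: "top_sum \<mu> (Suc (row_index i)) = top_sum \<mu> (row_index i) + \<mu> i"
proof -
  have "{j. row_index j < Suc (row_index i)} = insert i {j. row_index j < row_index i}"
    by (auto simp: less_Suc_eq_le)
  then show ?thesis
    by (simp add: top_sum_def)
qed

text \<open>
  Dominance is phrased by initial segments \<open>{..j}\<close>; phrased by the number of rows it can be combined
  with bounds that only depend on the cardinality of a set.
\<close>

lemma dominates_iff_top_sum:
  "\<beta> \<unrhd> \<alpha> \<longleftrightarrow> psize \<beta> = psize \<alpha> \<and> (\<forall>k. top_sum \<alpha> k \<le> top_sum \<beta> k)"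
  (is "_ \<longleftrightarrow> _ \<and> ?tops")
proof -
  have initial: "sum \<mu> {..j} = top_sum \<mu> (Suc (row_index j))" for \<mu> :: "'a \<Rightarrow> nat" and j
    by (simp add: top_sum_def less_Suc_eq_le atMost_def)
  have "?tops" if eq: "psize \<beta> = psize \<alpha>" and le: "\<forall>j. sum \<alpha> {..j} \<le> sum \<beta> {..j}"
  proof
    fix k
    consider "k = 0" | "k > CARD('a)" | j where "k = Suc (row_index (j :: 'a))"
    proof (cases k)
      case (Suc k')
      show ?thesis
      proof (cases "k' < CARD('a)")
        case True
        then obtain j :: 'a where "row_index j = k'" by (rule obtain_row)
        with Suc show ?thesis using that(3) by blast
      next
        case False
        with Suc show ?thesis using that(2) by simp
      qed
    qed (use that(1) in blast)
    then show "top_sum \<alpha> k \<le> top_sum \<beta> k"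
    proof cases
      case 1
      then show ?thesis by (simp add: top_sum_def)
    next
      case 2
      then have "{i :: 'a. row_index i < k} = UNIV"
        using row_index_less_CARD less_trans by blast
      then show ?thesis
        using eq by (simp add: top_sum_def psize_def)
    next
      case (3 j)
      then show ?thesis
        using le initial by metis
    qed
  qed
  then show ?thesis
    unfolding dominates_def using initial by metis
qed

lemma dominates_antisym:
  assumes "\<mu> \<unrhd> \<nu>" "\<nu> \<unrhd> \<mu>"
  shows "\<mu> = \<nu>"
proof
  fix i
  have "top_sum \<mu> k = top_sum \<nu> k" for k
    using assms by (simp add: dominates_iff_top_sum le_antisym)
  then show "\<mu> i = \<nu> i"
    by (metis add_left_cancel top_sum_Suc_row_index)
qed

section \<open>Greedy partitions\<close>

text \<open>
  At most one row is strictly between \<open>\<alpha>\<close> and \<open>\<beta>\<close>; the rows above it are those of \<open>\<beta>\<close> and the rows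
  below it are those of \<open>\<alpha>\<close>. Stating this for pairs of rows avoids naming that row, which need not
  exist.
\<close>

definition greedy :: "('m::{finite,linorder} \<Rightarrow> nat) \<Rightarrow> ('m \<Rightarrow> nat) \<Rightarrow> ('m \<Rightarrow> nat) \<Rightarrow> bool" where
  "greedy \<alpha> \<beta> \<mu> \<longleftrightarrow> is_partition \<mu> \<and> \<alpha> \<le> \<mu> \<and> \<mu> \<le> \<beta> \<and>
     (\<forall>i j. i < j \<longrightarrow> \<mu> i = \<beta> i \<or> \<mu> j = \<alpha> j)"

text \<open>
  If some row among the first \<open>k\<close> is not yet full, then all rows after them are still those of \<open>\<alpha>\<close>.
\<close>

lemma greedy_top_or_tail:
  assumes "greedy \<alpha> \<beta> \<mu>"
  shows "top_sum \<mu> k = top_sum \<beta> k \<or> tail_sum \<mu> k = tail_sum \<alpha> k"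
proof (cases "\<forall>i. row_index i < k \<longrightarrow> \<mu> i = \<beta> i")
  case True
  then show ?thesis by (simp add: top_sum_def)
next
  case False
  then obtain i where i: "row_index i < k" "\<mu> i \<noteq> \<beta> i" by blast
  have "\<mu> j = \<alpha> j" if "k \<le> row_index j" for j
    using assms i that unfolding greedy_def by (metis order_less_le_trans row_index_less_iff)
  then show ?thesis by (simp add: tail_sum_def)
qed

text \<open>
  Each initial sum is either that of \<open>\<beta>\<close>, which no partition below \<open>\<beta>\<close> exceeds, or it is the size
  minus a final sum of \<open>\<alpha>\<close>, which no partition above \<open>\<alpha>\<close> undercuts.
\<close>

lemma greedy_dominates:
  assumes "greedy \<alpha> \<beta> \<mu>" "\<alpha> \<le> \<nu>" "\<nu> \<le> \<beta>" "psize \<nu> = psize \<mu>"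
  shows "\<mu> \<unrhd> \<nu>"
proof -
  have "top_sum \<nu> k \<le> top_sum \<mu> k" for k
    using greedy_top_or_tail[OF assms(1), of k] top_sum_mono[OF assms(3), of k]
      tail_sum_mono[OF assms(2), of k] top_plus_tail[of \<mu> k] top_plus_tail[of \<nu> k] assms(4)
    by linarith
  then show ?thesis
    using assms(4) by (simp add: dominates_iff_top_sum)
qed

lemma greedy_unique:
  assumes "greedy \<alpha> \<beta> \<mu>" "greedy \<alpha> \<beta> \<nu>" "psize \<mu> = psize \<nu>"
  shows "\<mu> = \<nu>"
  using assms greedy_dominates by (intro dominates_antisym) (auto simp: greedy_def)

lemma psize_add_box: "psize (add_box \<mu> r) = Suc (psize \<mu>)"
proof -
  have "psize (add_box \<mu> r) = (\<Sum>i\<in>UNIV. \<mu> i + (if i = r then 1 else 0))"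
    unfolding psize_def add_box_def by (rule sum.cong) auto
  then show ?thesis
    by (simp add: sum.distrib psize_def)
qed

lemma less_add_box: "\<mu> \<le> \<nu> \<Longrightarrow> \<mu> < add_box \<nu> r"
proof (rule order_le_neq_trans)
  assume le: "\<mu> \<le> \<nu>"
  then show "\<mu> \<le> add_box \<nu> r"
    by (simp add: le_fun_def add_box_def le_SucI)
  have "\<mu> r \<le> \<nu> r" using le by (simp add: le_fun_def)
  then show "\<mu> \<noteq> add_box \<nu> r"
    by (auto simp: add_box_def dest: fun_cong[of _ _ r])
qed

text \<open>
  In the first row that is shorter than in \<open>\<beta>\<close> a box fits: the rows above it already have the lengths
  that they have in \<open>\<beta>\<close>, so they are long enough.
\<close>

lemma admissible_row_first_deficient:
  assumes "is_partition \<beta>" "greedy \<alpha> \<beta> \<mu>" "\<mu> r < \<beta> r" "\<And>i. i < r \<Longrightarrow> \<mu> i = \<beta> i"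
  shows "admissible_row \<alpha> \<beta> \<mu> r"
proof -
  have \<mu>: "is_partition \<mu>" "\<alpha> \<le> \<mu>" "\<mu> \<le> \<beta>"
    using assms(2) by (auto simp: greedy_def)
  have "Suc (\<mu> r) \<le> \<mu> i" if "i < r" for i
    using that assms(1,3,4) unfolding is_partition_def
    by (metis Suc_leI dual_order.strict_iff_order order_less_le_trans)
  then have "is_partition (add_box \<mu> r)"
    using \<mu>(1) by (auto simp: is_partition_def add_box_def le_SucI)
  moreover have "\<alpha> < add_box \<mu> r"
    using \<mu>(2) by (rule less_add_box)
  moreover have "add_box \<mu> r \<le> \<beta>"
    using \<mu>(3) assms(3) by (auto simp: le_fun_def add_box_def)
  ultimately show ?thesis
    by (simp add: admissible_row_def)
qed

lemma finite_linorder_least: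
  fixes P :: "'m::{finite,linorder} \<Rightarrow> bool"
  assumes "P i"
  obtains r where "P r" "\<And>j. j < r \<Longrightarrow> \<not> P j"
proof
  show "P (Min {i. P i})"
    using Min_in[of "{i. P i}"] assms by auto
  show "\<not> P j" if "j < Min {i. P i}" for j
    using that Min_le[of "{i. P i}" j] by (metis finite mem_Collect_eq not_le)
qed

lemma northmost_step_exists:
  assumes "is_partition \<beta>" "greedy \<alpha> \<beta> \<mu>" "\<mu> \<noteq> \<beta>"
  shows "\<exists>\<nu>. northmost_step \<alpha> \<beta> \<mu> \<nu>"
proof -
  have le: "\<mu> i \<le> \<beta> i" for i
    using assms(2) by (simp add: greedy_def le_fun_def)
  obtain i where "\<mu> i < \<beta> i"
    using assms(3) le by (meson ext order_le_neq_trans)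
  then obtain r where "\<mu> r < \<beta> r" "\<And>j. j < r \<Longrightarrow> \<not> \<mu> j < \<beta> j"
    by (rule finite_linorder_least[of "\<lambda>i. \<mu> i < \<beta> i"]) blast
  then have "admissible_row \<alpha> \<beta> \<mu> r"
    using admissible_row_first_deficient[OF assms(1,2)] le by (meson linorder_neqE_nat not_le)
  then show ?thesis
    unfolding northmost_step_def by (metis finite_linorder_least)
qed

text \<open>
  A northmost step stays greedy: had it passed over a deficient row, the first such row would have been
  an admissible row further north.
\<close>

lemma greedy_northmost_step:
  assumes "is_partition \<beta>" "greedy \<alpha> \<beta> \<mu>" "northmost_step \<alpha> \<beta> \<mu> \<nu>"
  shows "greedy \<alpha> \<beta> \<nu>" "psize \<nu> = Suc (psize \<mu>)"
proof -
  obtain r where r: "admissible_row \<alpha> \<beta> \<mu> r" "\<And>r'. r' < r \<Longrightarrow> \<not> admissible_row \<alpha> \<beta> \<mu> r'"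
    and \<nu>: "\<nu> = add_box \<mu> r"
    using assms(3) by (auto simp: northmost_step_def)
  have \<mu>: "is_partition \<mu>" "\<alpha> \<le> \<mu>" "\<mu> \<le> \<beta>"
    and gr: "\<And>i j. i < j \<Longrightarrow> \<mu> i = \<beta> i \<or> \<mu> j = \<alpha> j"
    using assms(2) by (auto simp: greedy_def)
  have le: "\<mu> i \<le> \<beta> i" for i
    using \<mu>(3) by (simp add: le_fun_def)
  have full: "\<mu> i = \<beta> i" if "i < r" for i
  proof (rule ccontr)
    assume "\<mu> i \<noteq> \<beta> i"
    then have "\<mu> i \<noteq> \<beta> i \<and> i < r" using that by simp
    then obtain s where s: "\<mu> s \<noteq> \<beta> s \<and> s < r" "\<And>j. j < s \<Longrightarrow> \<not> (\<mu> j \<noteq> \<beta> j \<and> j < r)"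
      by (rule finite_linorder_least[of "\<lambda>i. \<mu> i \<noteq> \<beta> i \<and> i < r"]) blast
    have "admissible_row \<alpha> \<beta> \<mu> s"
      using s le by (intro admissible_row_first_deficient[OF assms(1,2)])
        (auto simp: order_le_neq_trans)
    then show False using r(2) s(1) by blast
  qed
  have adm: "is_partition \<nu>" "\<alpha> < \<nu>" "\<nu> \<le> \<beta>"
    using r(1) \<nu> by (auto simp: admissible_row_def)
  have "\<mu> r < \<beta> r"
    using adm(3) \<nu> by (auto simp: le_fun_def add_box_def Suc_le_eq dest: spec[of _ r])
  then have "\<nu> i = \<beta> i \<or> \<nu> j = \<alpha> j" if "i < j" for i j
    using gr[OF that] full[of i] that \<nu> gr[of r j]
    by (auto simp: add_box_def)
  then show "greedy \<alpha> \<beta> \<nu>"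
    using adm by (simp add: greedy_def less_imp_le)
  show "psize \<nu> = Suc (psize \<mu>)"
    using \<nu> by (simp add: psize_add_box)
qed

lemma greedy_along_chain:
  assumes "is_partition \<alpha>" "is_partition \<beta>" "\<alpha> \<le> \<beta>"
    and "\<Lambda> 0 = \<alpha>" "\<And>i. i < l \<Longrightarrow> northmost_step \<alpha> \<beta> (\<Lambda> i) (\<Lambda> (Suc i))"
    and "i \<le> l"
  shows "greedy \<alpha> \<beta> (\<Lambda> i) \<and> psize (\<Lambda> i) = psize \<alpha> + i"
  using assms(6)
proof (induction i)
  case 0
  then show ?case using assms(1,3,4) by (simp add: greedy_def)
next
  case (Suc i)
  then show ?case
    using greedy_northmost_step[OF assms(2)] assms(5)[of i] by auto
qed

lemma northmost_chain_exists:
  assumes "is_partition \<alpha>" "is_partition \<beta>" "\<alpha> \<le> \<beta>"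
  obtains \<Lambda> where "\<Lambda> 0 = \<alpha>"
    "\<And>i. i < psize \<beta> - psize \<alpha> \<Longrightarrow> northmost_step \<alpha> \<beta> (\<Lambda> i) (\<Lambda> (Suc i))"
proof -
  \<comment> \<open>Once \<open>\<beta>\<close> is reached no step is left and the choice is arbitrary.\<close>
  define \<Lambda> where "\<Lambda> = rec_nat \<alpha> (\<lambda>_ \<mu>. SOME \<nu>. northmost_step \<alpha> \<beta> \<mu> \<nu>)"
  have \<Lambda>: "\<Lambda> 0 = \<alpha>" "\<And>i. \<Lambda> (Suc i) = (SOME \<nu>. northmost_step \<alpha> \<beta> (\<Lambda> i) \<nu>)"
    by (simp_all add: \<Lambda>_def)
  have "northmost_step \<alpha> \<beta> (\<Lambda> i) (\<Lambda> (Suc i))" if "i < psize \<beta> - psize \<alpha>" for i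
    using that
  proof (induction i rule: less_induct)
    case (less i)
    then have "greedy \<alpha> \<beta> (\<Lambda> i) \<and> psize (\<Lambda> i) = psize \<alpha> + i"
      by (intro greedy_along_chain[where \<Lambda> = \<Lambda> and l = i] assms \<Lambda>(1)) auto
    moreover from this have "\<Lambda> i \<noteq> \<beta>"
      using less.prems by auto
    ultimately show ?case
      unfolding \<Lambda>(2) by (metis northmost_step_exists[OF assms(2)] someI_ex)
  qed
  with \<Lambda>(1) show ?thesis by (rule that)
qed

lemma greedy_exists:
  assumes "is_partition \<alpha>" "is_partition \<beta>" "\<alpha> \<le> \<beta>" "psize \<alpha> \<le> d" "d \<le> psize \<beta>"
  obtains \<mu> where "greedy \<alpha> \<beta> \<mu>" "psize \<mu> = d"
proof -
  obtain \<Lambda> where "\<Lambda> 0 = \<alpha>"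
    "\<And>i. i < psize \<beta> - psize \<alpha> \<Longrightarrow> northmost_step \<alpha> \<beta> (\<Lambda> i) (\<Lambda> (Suc i))"
    using northmost_chain_exists[OF assms(1-3)] by blast
  then have "greedy \<alpha> \<beta> (\<Lambda> (d - psize \<alpha>)) \<and> psize (\<Lambda> (d - psize \<alpha>)) = psize \<alpha> + (d - psize \<alpha>)"
    using assms(5) by (intro greedy_along_chain[where \<Lambda> = \<Lambda> and l = "d - psize \<alpha>"] assms) auto
  then show ?thesis
    using assms(4) that by auto
qed

section \<open>Contents of semistandard tableaux\<close>

definition tableau_content :: "('m::{finite,linorder} \<Rightarrow> nat) \<Rightarrow> ('m \<times> nat \<Rightarrow> 'm) \<Rightarrow> 'm \<Rightarrow> nat" where
  "tableau_content \<mu> T i = card {c \<in> diagram \<mu>. T c = i}"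

lemma card_diagram: "card (diagram \<mu>) = psize \<mu>"
proof -
  have "diagram \<mu> = (SIGMA i:UNIV. {..<\<mu> i})"
    by (auto simp: diagram_def)
  then show ?thesis by (simp add: psize_def)
qed

lemma sum_content: "sum (tableau_content \<mu> T) S = card {c \<in> diagram \<mu>. T c \<in> S}"
proof -
  have "{c \<in> diagram \<mu>. T c \<in> S} = (\<Union>i\<in>S. {c \<in> diagram \<mu>. T c = i})"
    by auto
  moreover have "card (\<Union>i\<in>S. {c \<in> diagram \<mu>. T c = i}) = sum (tableau_content \<mu> T) S"
    unfolding tableau_content_def by (rule card_UN_disjoint) (auto simp: finite_diagram)
  ultimately show ?thesis by simp
qed

lemma psize_content: "psize (tableau_content \<mu> T) = psize \<mu>"
  unfolding psize_def[of "tableau_content \<mu> T"] by (simp add: sum_content card_diagram)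

text \<open>
  A column of \<open>\<mu>\<close> has distinct entries, so at most \<open>|S|\<close> of them are in \<open>S\<close>; the bound
  \<open>min |S| (column length)\<close> is the number of boxes of the column in the first \<open>|S|\<close> rows.
\<close>

lemma sum_content_le_top_sum:
  fixes \<mu> :: "'m::{finite,linorder} \<Rightarrow> nat"
  assumes "is_partition \<mu>" "T \<in> SSYT \<mu>"
  shows "sum (tableau_content \<mu> T) S \<le> top_sum \<mu> (card S)"
proof -
  define N where "N = psize \<mu>"
  have bound: "\<mu> i \<le> N" for i
    unfolding N_def psize_def by (rule member_le_sum) auto
  have S_boxes: "{c \<in> diagram \<mu>. T c \<in> S}
      = prod.swap ` (SIGMA j:{..<N}. {i. j < \<mu> i \<and> T (i, j) \<in> S})"
    using bound order_less_le_trans by (fastforce simp: diagram_def)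
  have top_boxes: "top_sum \<mu> k = (\<Sum>j<N. card {i. j < \<mu> i \<and> row_index i < k})" for k
  proof -
    have "top_sum \<mu> k = card (SIGMA i:{i. row_index i < k}. {..<\<mu> i})"
      by (simp add: top_sum_def)
    also have "(SIGMA i:{i. row_index i < k}. {..<\<mu> i})
        = prod.swap ` (SIGMA j:{..<N}. {i. j < \<mu> i \<and> row_index i < k})"
      using bound order_less_le_trans by fastforce
    also have "card \<dots> = (\<Sum>j<N. card {i. j < \<mu> i \<and> row_index i < k})"
      by (simp add: card_image)
    finally show ?thesis .
  qed
  have column: "card {i. j < \<mu> i \<and> T (i, j) \<in> S} \<le> card {i. j < \<mu> i \<and> row_index i < card S}" for j
  proof (cases "\<forall>i. j < \<mu> i \<longrightarrow> row_index i < card S")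
    case True
    then show ?thesis by (intro card_mono) auto
  next
    case False
    then obtain i0 where i0: "j < \<mu> i0" "card S \<le> row_index i0" by (auto simp: not_less)
    have "j < \<mu> i" if "row_index i < card S" for i
    proof -
      have "i \<le> i0" using that i0(2) by (simp flip: row_index_le_iff)
      then have "\<mu> i0 \<le> \<mu> i" using assms(1) by (simp add: is_partition_def)
      then show ?thesis using i0(1) by simp
    qed
    then have "{i. j < \<mu> i \<and> row_index i < card S} = {i. row_index i < card S}" by auto
    then have "card {i. j < \<mu> i \<and> row_index i < card S} = card S"
      by (simp add: card_row_index_less card_mono)
    moreover have "inj_on (\<lambda>i. T (i, j)) {i. j < \<mu> i \<and> T (i, j) \<in> S}"
    proof (rule linorder_inj_onI)
      fix x y assume "x < y" "x \<in> {i. j < \<mu> i \<and> T (i, j) \<in> S}" "y \<in> {i. j < \<mu> i \<and> T (i, j) \<in> S}"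
      then have "T (x, j) < T (y, j)"
        using assms(2) by (auto simp: SSYT_def diagram_def)
      then show "T (x, j) \<noteq> T (y, j)" by simp
    qed auto
    then have "card {i. j < \<mu> i \<and> T (i, j) \<in> S} \<le> card S"
      by (rule card_inj_on_le) auto
    ultimately show ?thesis by simp
  qed
  have "sum (tableau_content \<mu> T) S = (\<Sum>j<N. card {i. j < \<mu> i \<and> T (i, j) \<in> S})"
    unfolding sum_content S_boxes by (simp add: card_image)
  also have "\<dots> \<le> (\<Sum>j<N. card {i. j < \<mu> i \<and> row_index i < card S})"
    by (rule sum_mono) (rule column)
  also have "\<dots> = top_sum \<mu> (card S)"
    by (simp add: top_boxes)
  finally show ?thesis .
qed

text \<open>
  The diagram without its first row, every other row moving up by one. The sum has one term, or none
  in the last row, whose successor then counts as empty. A skew shape \<open>\<mu>/\<nu>\<close> is a horizontal strip iff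
  \<open>next_row \<mu> \<le> \<nu> \<le> \<mu>\<close>.
\<close>

definition next_row :: "('m::{finite,linorder} \<Rightarrow> nat) \<Rightarrow> 'm \<Rightarrow> nat" where
  "next_row \<mu> i = (\<Sum>j | row_index j = Suc (row_index i). \<mu> j)"

lemma next_row_cases:
  fixes i :: "'m::{finite,linorder}"
  obtains "next_row \<mu> i = 0" "Suc (row_index i) = CARD('m)"
  | j where "row_index j = Suc (row_index i)" "next_row \<mu> i = \<mu> j"
proof (cases "Suc (row_index i) = CARD('m)")
  case True
  then have "{j :: 'm. row_index j = Suc (row_index i)} = {}"
    using row_index_less_CARD[where 'm = 'm] by (metis (mono_tags) Collect_empty_eq less_irrefl)
  then have "next_row \<mu> i = 0"
    unfolding next_row_def by (simp only: sum.empty)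
  then show ?thesis using True that(1) by blast
next
  case False
  then obtain j :: 'm where j: "row_index j = Suc (row_index i)"
    using row_index_less_CARD[of i] by (meson Suc_lessI obtain_row)
  then have "{k. row_index k = Suc (row_index i)} = {j}"
    by (metis (mono_tags, lifting) Collect_cong row_index_eq_iff singleton_conv)
  then have "next_row \<mu> i = \<mu> j"
    by (simp add: next_row_def)
  with j show ?thesis by (rule that(2))
qed

lemma next_row_ge:
  assumes "is_partition \<mu>" "i < j"
  shows "\<mu> j \<le> next_row \<mu> i"
proof (cases rule: next_row_cases[of \<mu> i])
  case 1
  then show ?thesis
    using assms(2) row_index_less_CARD[of j] by (metis Suc_leI not_le row_index_less_iff)
next
  case (2 k)
  then have "k \<le> j"
    using assms(2) by (metis Suc_leI row_index_le_iff row_index_less_iff)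
  then show ?thesis
    using assms(1) 2(2) by (simp add: is_partition_def)
qed

lemma next_row_le:
  assumes "is_partition \<mu>"
  shows "next_row \<mu> i \<le> \<mu> i"
proof (cases rule: next_row_cases[of \<mu> i])
  case (2 k)
  then have "i \<le> k"
    by (metis le_SucI order_refl row_index_le_iff)
  then show ?thesis
    using assms 2(2) by (simp add: is_partition_def)
qed simp

lemma is_partition_next_row:
  assumes "is_partition \<mu>"
  shows "is_partition (next_row \<mu>)"
  unfolding is_partition_def
  using next_row_ge[OF assms] next_row_le[OF assms] by (metis order.order_iff_strict order_trans)

lemma tail_sum_next_row:
  fixes \<mu> :: "'m::{finite,linorder} \<Rightarrow> nat"
  shows "tail_sum (next_row \<mu>) k = tail_sum \<mu> (Suc k)"
proof -
  have "tail_sum (next_row \<mu>) k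
      = (\<Sum>i::'m | k \<le> row_index i. \<Sum>j\<in>{j \<in> UNIV. row_index j = Suc (row_index i)}. \<mu> j)"
    by (simp add: tail_sum_def next_row_def)
  also have "\<dots> = (\<Sum>j\<in>UNIV. \<Sum>i::'m | i \<in> {i. k \<le> row_index i} \<and> row_index j = Suc (row_index i). \<mu> j)"
    by (rule sum.swap_restrict) auto
  also have "\<dots> = (\<Sum>j\<in>UNIV. if Suc k \<le> row_index j then \<mu> j else 0)"
  proof (rule sum.cong)
    fix j
    show "(\<Sum>i::'m | i \<in> {i. k \<le> row_index i} \<and> row_index j = Suc (row_index i). \<mu> j)
        = (if Suc k \<le> row_index j then \<mu> j else 0)"
    proof (cases "Suc k \<le> row_index j")
      case True
      then obtain i :: 'm where i: "row_index i = row_index j - 1"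
        using obtain_row[of "row_index j - 1", where 'm = 'm] row_index_less_CARD[of j] by (metis less_imp_diff_less)
      then have "{i::'m. i \<in> {i. k \<le> row_index i} \<and> row_index j = Suc (row_index i)} = {i}"
        using True by (auto simp flip: row_index_eq_iff)
      then show ?thesis
        using True by simp
    next
      case False
      then have none: "{i::'m. i \<in> {i. k \<le> row_index i} \<and> row_index j = Suc (row_index i)} = {}"
        by auto
      show ?thesis
        unfolding none using False by simp
    qed
  qed simp
  also have "\<dots> = tail_sum \<mu> (Suc k)"
    by (simp add: tail_sum_def sum.If_cases)
  finally show ?thesis .
qed

text \<open>
  Filling a horizontal strip with a letter larger than all others keeps the tableau semistandard: no
  column contains two boxes of the strip.
\<close>

lemma extend_tableau:
  assumes "is_partition \<mu>" "next_row \<mu> \<le> \<nu>" "\<nu> \<le> \<mu>"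
    and "T \<in> SSYT \<nu>" "\<And>c. c \<in> diagram \<nu> \<Longrightarrow> T c < r"
  defines "U \<equiv> restrict (\<lambda>c. if c \<in> diagram \<nu> then T c else r) (diagram \<mu>)"
  shows "U \<in> SSYT \<mu>"
    and "tableau_content \<mu> U = (tableau_content \<nu> T)(r := psize \<mu> - psize \<nu>)"
    and "\<And>c. c \<in> diagram \<mu> \<Longrightarrow> U c \<le> r"
proof -
  have sub: "diagram \<nu> \<subseteq> diagram \<mu>"
    using assms(3) by (auto simp: diagram_def le_fun_def intro: order_less_le_trans)
  have U: "U c = (if c \<in> diagram \<nu> then T c else r)" if "c \<in> diagram \<mu>" for c
    using that by (simp add: U_def)
  show Ule: "U c \<le> r" if "c \<in> diagram \<mu>" for c
    using U[OF that] assms(5)[of c] by auto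
  have rows: "U (i, j) \<le> U (i, j')"
    if "j < j'" "(i, j) \<in> diagram \<mu>" "(i, j') \<in> diagram \<mu>" for i j j'
  proof (cases "(i, j') \<in> diagram \<nu>")
    case True
    moreover from this have "(i, j) \<in> diagram \<nu>" using that(1) by (auto simp: diagram_def)
    ultimately show ?thesis
      using U that assms(4) by (auto simp: SSYT_def)
  next
    case False
    then show ?thesis using U that(3) Ule[OF that(2)] by simp
  qed
  have columns: "U (i, j) < U (i', j)"
    if "i < i'" "(i, j) \<in> diagram \<mu>" "(i', j) \<in> diagram \<mu>" for i i' j
  proof -
    have "\<mu> i' \<le> \<nu> i"
      using next_row_ge[OF assms(1) that(1)] assms(2) by (metis le_fun_def order_trans)
    then have in\<nu>: "(i, j) \<in> diagram \<nu>"
      using that(3) by (simp add: diagram_def)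
    show ?thesis
    proof (cases "(i', j) \<in> diagram \<nu>")
      case True
      then show ?thesis
        using U that in\<nu> assms(4) by (auto simp: SSYT_def)
    next
      case False
      then show ?thesis
        using U that(2,3) in\<nu> assms(5) by auto
    qed
  qed
  show "U \<in> SSYT \<mu>"
    unfolding SSYT_def using rows columns by (auto simp: U_def)
  show "tableau_content \<mu> U = (tableau_content \<nu> T)(r := psize \<mu> - psize \<nu>)"
  proof
    fix k
    show "tableau_content \<mu> U k = ((tableau_content \<nu> T)(r := psize \<mu> - psize \<nu>)) k"
    proof (cases "k = r")
      case True
      have "{c \<in> diagram \<mu>. U c = r} = diagram \<mu> - diagram \<nu>"
        using U assms(5) sub by fastforce
      then show ?thesis
        using True sub by (simp add: tableau_content_def card_Diff_subset finite_diagram card_diagram)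
    next
      case False
      then have "{c \<in> diagram \<mu>. U c = k} = {c \<in> diagram \<nu>. T c = k}"
        using U sub by (auto split: if_splits)
      then show ?thesis
        using False by (simp add: tableau_content_def)
    qed
  qed
qed

text \<open>
  Induction on the number \<open>n\<close> of rows and letters that may be used. The boxes with the largest letter
  \<open>r\<close> must form a horizontal strip of size \<open>a r\<close> that contains the whole last row. The partition
  \<open>\<nu>\<close> that remains is chosen greedily, hence as dominant as possible: where an initial sum of \<open>\<nu>\<close>
  over \<open>k\<close> rows is not that of \<open>\<mu>\<close>, it equals the sum of the first \<open>k + 1\<close> rows of \<open>\<mu>\<close> minus \<open>a r\<close>,
  and the bound needed for a set \<open>S\<close> of smaller letters is the given bound for \<open>S \<union> {r}\<close>.
\<close>

lemma tableau_exists_bounded: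
  fixes \<mu> a :: "'m::{finite,linorder} \<Rightarrow> nat"
  assumes "is_partition \<mu>" "n \<le> CARD('m)"
    and "\<And>i. n \<le> row_index i \<Longrightarrow> \<mu> i = 0" "\<And>i. n \<le> row_index i \<Longrightarrow> a i = 0"
    and "\<And>S. sum a S \<le> top_sum \<mu> (card S)" "psize a = psize \<mu>"
  shows "\<exists>T\<in>SSYT \<mu>. (\<forall>c\<in>diagram \<mu>. row_index (T c) < n) \<and> tableau_content \<mu> T = a"
  using assms
proof (induction n arbitrary: \<mu> a)
  case 0
  then have "diagram \<mu> = {}" "a = (\<lambda>_. 0)"
    by (auto simp: diagram_def)
  then show ?case
    by (auto simp: SSYT_def tableau_content_def intro!: bexI[of _ "\<lambda>_. undefined"])
next
  case (Suc n)
  note part = Suc.prems(1) and supp\<mu> = Suc.prems(3) and suppa = Suc.prems(4)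
    and dom = Suc.prems(5) and size = Suc.prems(6)
  obtain r :: 'm where r: "row_index r = n"
    using Suc.prems(2) by (metis Suc_le_eq obtain_row)
  define u where "u = \<mu>(r := 0)"
  have below: "row_index i < n \<longleftrightarrow> i < r" for i using r by auto
  have u_part: "is_partition u"
    using part supp\<mu> r unfolding is_partition_def u_def
    by (auto simp: not_less_eq_eq Suc_le_eq)
  have le_u: "next_row \<mu> \<le> u"
  proof (rule le_funI)
    fix i
    have "next_row \<mu> r = 0"
      by (cases rule: next_row_cases[of \<mu> r]) (use supp\<mu> r in auto)
    then show "next_row \<mu> i \<le> u i"
      using next_row_le[OF part, of i] by (simp add: u_def)
  qed
  have u_size: "psize u + \<mu> r = psize \<mu>"
    unfolding psize_def u_def by (simp add: sum.remove[of UNIV r])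
  have top_u: "top_sum u k = top_sum \<mu> k" if "k \<le> n" for k
    unfolding top_sum_def u_def by (rule sum.cong) (use that r in auto)
  \<comment> \<open>The remaining letters fit into the first \<open>n\<close> rows, so at least \<open>\<mu> r\<close> copies of \<open>r\<close> are there.\<close>
  have a_lower: "\<mu> r \<le> a r"
  proof -
    have split: "psize f = (\<Sum>i\<in>{i. i < r}. f i) + f r" if "\<And>i. Suc n \<le> row_index i \<Longrightarrow> f i = 0" for f :: "'m \<Rightarrow> nat"
    proof -
      have "psize f = sum f (insert r {i. i < r})"
        unfolding psize_def
        by (rule sum.mono_neutral_right)
          (use that r in \<open>auto simp: Suc_le_eq elim!: linorder_neqE\<close>)
      then show ?thesis by (simp add: add.commute)
    qed
    have "card {i. i < r} = n"
      using r by (simp add: row_index_def lessThan_def)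
    then have "sum a {i. i < r} \<le> (\<Sum>i\<in>{i. i < r}. \<mu> i)"
      using dom[of "{i. i < r}"] by (simp add: top_sum_def below)
    then show ?thesis
      using split[of a] split[of \<mu>] suppa supp\<mu> size by simp
  qed
  have tail1: "psize (next_row \<mu>) = tail_sum \<mu> 1"
    using tail_sum_next_row[of \<mu> 0] by (simp add: tail_sum_0)
  have a_upper: "a r \<le> top_sum \<mu> 1"
    using dom[of "{r}"] by simp
  obtain \<nu> where \<nu>: "greedy (next_row \<mu>) u \<nu>" "psize \<nu> = psize \<mu> - a r"
  proof (rule greedy_exists[OF is_partition_next_row[OF part] u_part le_u])
    show "psize (next_row \<mu>) \<le> psize \<mu> - a r"
      using tail1 a_upper top_plus_tail[of \<mu> 1] by linarith
    show "psize \<mu> - a r \<le> psize u"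
      using u_size a_lower by linarith
  qed
  have ar: "a r \<le> psize \<mu>"
    using a_upper top_plus_tail[of \<mu> 1] by linarith
  have \<nu>_bounds: "is_partition \<nu>" "next_row \<mu> \<le> \<nu>" "\<nu> \<le> u"
    using \<nu>(1) by (auto simp: greedy_def)
  have "\<exists>T\<in>SSYT \<nu>. (\<forall>c\<in>diagram \<nu>. row_index (T c) < n) \<and> tableau_content \<nu> T = a(r := 0)"
  proof (rule Suc.IH[OF \<nu>_bounds(1)])
    show "n \<le> CARD('m)" using Suc.prems(2) by simp
    show "\<nu> i = 0" if "n \<le> row_index i" for i
    proof -
      have "u i = 0"
        using that supp\<mu>[of i] r unfolding u_def
        by (cases "i = r") (auto simp: Suc_le_eq simp flip: row_index_eq_iff)
      then show ?thesis using \<nu>_bounds(3) by (metis le_fun_def le_zero_eq)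
    qed
    show "(a(r := 0)) i = 0" if "n \<le> row_index i" for i
      using that suppa[of i] r
      by (cases "i = r") (auto simp: Suc_le_eq simp flip: row_index_eq_iff)
    show "psize (a(r := 0)) = psize \<nu>"
    proof -
      have "psize (a(r := 0)) + a r = psize a"
        unfolding psize_def by (simp add: sum.remove[of UNIV r])
      then show ?thesis using \<nu>(2) size by simp
    qed
    show "sum (a(r := 0)) S \<le> top_sum \<nu> (card S)" for S
    proof -
      \<comment> \<open>Letters above \<open>r\<close> do not occur and \<open>r\<close> has been removed, so only letters below \<open>r\<close> count.\<close>
      define S' where "S' = {i\<in>S. i < r}"
      have "sum (a(r := 0)) S = sum (a(r := 0)) S'"
        unfolding S'_def
        by (rule sum.mono_neutral_right)
          (use suppa r in \<open>auto simp: Suc_le_eq elim!: linorder_neqE\<close>)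
      also have "\<dots> = sum a S'"
        unfolding S'_def by (rule sum.cong) auto
      finally have sum_S: "sum (a(r := 0)) S = sum a S'" .
      have "card S' \<le> card {i. i < r}"
        unfolding S'_def by (intro card_mono) auto
      then have S'n: "card S' \<le> n"
        using r by (simp add: row_index_def lessThan_def)
      have "sum a S' \<le> top_sum \<nu> (card S')"
      proof (cases "top_sum \<nu> (card S') = top_sum u (card S')")
        case True
        then show ?thesis using top_u[OF S'n] dom[of S'] by simp
      next
        case False
        then have "tail_sum \<nu> (card S') = tail_sum \<mu> (Suc (card S'))"
          using greedy_top_or_tail[OF \<nu>(1)] tail_sum_next_row by metis
        moreover have "sum a S' + a r \<le> top_sum \<mu> (Suc (card S'))"
          using dom[of "insert r S'"] by (simp add: S'_def add.commute)
        ultimately show ?thesis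
          using top_plus_tail[of \<nu> "card S'"] top_plus_tail[of \<mu> "Suc (card S')"] \<nu>(2) ar
          by linarith
      qed
      also have "\<dots> \<le> top_sum \<nu> (card S)"
        by (intro top_sum_mono_index card_mono) (auto simp: S'_def)
      finally show ?thesis using sum_S by simp
    qed
  qed
  then obtain T where T: "T \<in> SSYT \<nu>" "\<And>c. c \<in> diagram \<nu> \<Longrightarrow> T c < r"
    "tableau_content \<nu> T = a(r := 0)"
    using below by auto
  have "u \<le> \<mu>" by (simp add: u_def le_fun_def)
  then have "\<nu> \<le> \<mu>" using \<nu>_bounds(3) by simp
  note U = extend_tableau[OF part \<nu>_bounds(2) this T(1,2)]
  have "tableau_content \<mu> (restrict (\<lambda>c. if c \<in> diagram \<nu> then T c else r) (diagram \<mu>)) = a"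
    using U(2) T(3) \<nu>(2) ar by (simp add: fun_eq_iff)
  with U(1,3) show ?case
    using r by (metis less_Suc_eq_le row_index_le_iff)
qed

lemma tableau_exists:
  fixes \<mu> a :: "'m::{finite,linorder} \<Rightarrow> nat"
  assumes "is_partition \<mu>" "\<And>S. sum a S \<le> top_sum \<mu> (card S)" "psize a = psize \<mu>"
  shows "a \<in> tableau_content \<mu> ` SSYT \<mu>"
  using tableau_exists_bounded[OF assms(1) order_refl _ _ assms(2,3)] row_index_less_CARD
  by (metis image_eqI not_le)

section \<open>The polytope of bounded subset sums\<close>

definition vec_of :: "('m \<Rightarrow> nat) \<Rightarrow> real ^ 'm" where
  "vec_of a = (\<chi> i. real (a i))"

text \<open>
  For a partition \<open>\<alpha> = \<beta>\<close> this is the permutohedron of \<open>\<alpha>\<close>, the convex hull of all rearrangements of \<open>\<alpha>\<close>; in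
  general, for partitions \<open>\<alpha> \<le> \<beta>\<close>, it is a generalized polymatroid. The lower bound is the sum of the \<open>card S\<close> smallest parts
  of \<open>\<alpha>\<close>, which are those in the last \<open>card S\<close> rows.
\<close>

definition subset_sum_polytope ::
    "('m::{finite,linorder} \<Rightarrow> nat) \<Rightarrow> ('m \<Rightarrow> nat) \<Rightarrow> (real ^ 'm::{finite,linorder}) set" where
  "subset_sum_polytope \<alpha> \<beta> =
     {x. \<forall>S. real (tail_sum \<alpha> (CARD('m) - card S)) \<le> (\<Sum>i\<in>S. x $ i) \<and>
             (\<Sum>i\<in>S. x $ i) \<le> real (top_sum \<beta> (card S))}"

lemma vec_of_in_subset_sum_polytope_iff:
  fixes a :: "'m::{finite,linorder} \<Rightarrow> nat"
  shows "vec_of a \<in> subset_sum_polytope \<alpha> \<beta> \<longleftrightarrow>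
    (\<forall>S. tail_sum \<alpha> (CARD('m) - card S) \<le> sum a S \<and> sum a S \<le> top_sum \<beta> (card S))"
  by (simp add: subset_sum_polytope_def vec_of_def flip: of_nat_sum)

lemma convex_subset_sum_polytope:
  fixes \<alpha> \<beta> :: "'m::{finite,linorder} \<Rightarrow> nat"
  shows "convex (subset_sum_polytope \<alpha> \<beta>)"
proof -
  have lin: "linear (\<lambda>x :: real ^ 'm::{finite,linorder}. \<Sum>i\<in>S. x $ i)" for S
    by (rule linearI) (simp_all add: sum.distrib sum_distrib_left)
  have "subset_sum_polytope \<alpha> \<beta> = (\<Inter>S. (\<lambda>x. \<Sum>i\<in>S. x $ i) -`
      {real (tail_sum \<alpha> (CARD('m) - card S)) .. real (top_sum \<beta> (card S))})"
    by (auto simp: subset_sum_polytope_def)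
  also have "convex \<dots>"
    by (intro convex_INT convex_linear_vimage lin) auto
  finally show ?thesis .
qed

lemma scaleR_in_subset_sum_polytope:
  assumes "x \<in> subset_sum_polytope \<alpha> \<beta>"
  shows "real t *\<^sub>R x \<in> subset_sum_polytope (\<lambda>i. t * \<alpha> i) (\<lambda>i. t * \<beta> i)"
  using assms
  by (auto simp: subset_sum_polytope_def tail_sum_def top_sum_def simp flip: sum_distrib_left
      intro!: mult_left_mono)

lemma card_complement: "card (- S) = CARD('m::finite) - card (S :: 'm set)"
  by (simp add: Compl_eq_Diff_UNIV card_Diff_subset)

text \<open>
  The lower bound for \<open>S\<close> is the upper bound for the complement of \<open>S\<close>, because the total is fixed.
\<close>

lemma dominated_in_subset_sum_polytope:
  fixes a :: "'m::{finite,linorder} \<Rightarrow> nat"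
  assumes "\<And>S. sum a S \<le> top_sum \<nu> (card S)" "psize a = psize \<nu>" "\<alpha> \<le> \<nu>" "\<nu> \<le> \<beta>"
  shows "vec_of a \<in> subset_sum_polytope \<alpha> \<beta>"
  unfolding vec_of_in_subset_sum_polytope_iff
proof (intro allI conjI)
  fix S :: "'m set"
  show "sum a S \<le> top_sum \<beta> (card S)"
    using assms(1) top_sum_mono[OF assms(4)] order_trans by blast
  have "psize a = sum a S + sum a (- S)"
    unfolding psize_def using sum.union_disjoint[of S "- S" a] by simp
  moreover have "sum a (- S) \<le> top_sum \<nu> (CARD('m) - card S)"
    using assms(1)[of "- S"] card_complement[of S] by simp
  ultimately show "tail_sum \<alpha> (CARD('m) - card S) \<le> sum a S"
    using assms(2) tail_sum_mono[OF assms(3), of "CARD('m) - card S"]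
      top_plus_tail[of \<nu> "CARD('m) - card S"]
    by linarith
qed

lemma content_in_subset_sum_polytope:
  assumes "is_partition \<nu>" "\<alpha> \<le> \<nu>" "\<nu> \<le> \<beta>" "T \<in> SSYT \<nu>"
  shows "vec_of (tableau_content \<nu> T) \<in> subset_sum_polytope \<alpha> \<beta>"
  using assms by (intro dominated_in_subset_sum_polytope[of _ \<nu>] sum_content_le_top_sum)
    (auto simp: psize_content)

text \<open>
  Converse of \<open>content_in_subset_sum_polytope\<close>, even with a greedy shape: among all shapes between \<open>\<alpha>\<close>
  and \<open>\<beta>\<close> of the size of \<open>a\<close>, the greedy one dominates and so has the weakest conditions on its
  contents.
\<close>

lemma greedy_tableau_of_lattice_point:
  fixes a :: "'m::{finite,linorder} \<Rightarrow> nat"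
  assumes "is_partition \<alpha>" "is_partition \<beta>" "\<alpha> \<le> \<beta>"
    and "vec_of a \<in> subset_sum_polytope \<alpha> \<beta>"
  obtains \<nu> T where "greedy \<alpha> \<beta> \<nu>" "T \<in> SSYT \<nu>" "a = tableau_content \<nu> T"
proof -
  have bounds: "tail_sum \<alpha> (CARD('m) - card S) \<le> sum a S" "sum a S \<le> top_sum \<beta> (card S)" for S
    using assms(4) by (auto simp: vec_of_in_subset_sum_polytope_iff)
  have "psize \<alpha> \<le> psize a" "psize a \<le> psize \<beta>"
    using bounds[of UNIV] by (auto simp: tail_sum_0 top_sum_CARD psize_def[of a])
  then obtain \<nu> where \<nu>: "greedy \<alpha> \<beta> \<nu>" "psize \<nu> = psize a"
    using greedy_exists[OF assms(1-3)] by metis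
  have "sum a S \<le> top_sum \<nu> (card S)" for S
  proof (cases "top_sum \<nu> (card S) = top_sum \<beta> (card S)")
    case True
    then show ?thesis using bounds(2) by simp
  next
    case False
    then have "tail_sum \<nu> (card S) = tail_sum \<alpha> (card S)"
      using greedy_top_or_tail[OF \<nu>(1)] by metis
    moreover have "psize a = sum a S + sum a (- S)"
      unfolding psize_def using sum.union_disjoint[of S "- S" a] by simp
    moreover have "tail_sum \<alpha> (card S) \<le> sum a (- S)"
      using bounds(1)[of "- S"] card_complement[of S] card_mono[of UNIV S] by simp
    ultimately show ?thesis
      using \<nu>(2) top_plus_tail[of \<nu> "card S"] by linarith
  qed
  then have "a \<in> tableau_content \<nu> ` SSYT \<nu>"
    using \<nu> by (intro tableau_exists) (auto simp: greedy_def)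
  with \<nu>(1) show ?thesis using that by blast
qed

section \<open>Splitting a tableau by columns\<close>

text \<open>
  The shape formed by the columns \<open>j, j + t, j + 2t, \<dots>\<close> of \<open>\<nu>\<close>: a row of length \<open>n\<close> has
  \<open>\<lceil>(n - j) / t\<rceil>\<close> boxes in these columns when \<open>j < t\<close>.
\<close>

definition slice_shape :: "nat \<Rightarrow> nat \<Rightarrow> ('m \<Rightarrow> nat) \<Rightarrow> 'm \<Rightarrow> nat" where
  "slice_shape t j \<nu> i = (\<nu> i + (t - 1 - j)) div t"

definition slice :: "nat \<Rightarrow> nat \<Rightarrow> ('m::{finite,linorder} \<Rightarrow> nat) \<Rightarrow> ('m \<times> nat \<Rightarrow> 'm) \<Rightarrow> 'm \<times> nat \<Rightarrow> 'm" where
  "slice t j \<nu> T = restrict (\<lambda>(i, c). T (i, t * c + j)) (diagram (slice_shape t j \<nu>))"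

lemma in_diagram_slice_shape:
  assumes "j < t"
  shows "(i, c) \<in> diagram (slice_shape t j \<nu>) \<longleftrightarrow> (i, t * c + j) \<in> diagram \<nu>"
proof -
  have "c < (\<nu> i + (t - 1 - j)) div t \<longleftrightarrow> Suc c * t \<le> \<nu> i + (t - 1 - j)"
    using assms by (simp only: less_eq_div_iff_mult_less_eq Suc_le_eq[symmetric])
  also have "\<dots> \<longleftrightarrow> t * c + j < \<nu> i"
    using assms by (auto simp: mult.commute)
  finally show ?thesis
    by (simp add: diagram_def slice_shape_def)
qed

lemma is_partition_slice_shape:
  assumes "is_partition \<nu>"
  shows "is_partition (slice_shape t j \<nu>)"
  using assms by (auto simp: is_partition_def slice_shape_def intro!: div_le_mono)

text \<open>
  A row of length \<open>t k\<close> contributes exactly \<open>k\<close> boxes to each of the \<open>t\<close> slices.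
\<close>

lemma slice_shape_between:
  assumes "j < t" "(\<lambda>i. t * \<alpha> i) \<le> \<nu>" "\<nu> \<le> (\<lambda>i. t * \<beta> i)"
  shows "\<alpha> \<le> slice_shape t j \<nu>" "slice_shape t j \<nu> \<le> \<beta>"
proof -
  have multiple: "(t * k + (t - 1 - j)) div t = k" for k
    by (rule div_nat_eqI) (use assms(1) in auto)
  have "(t * \<alpha> i + (t - 1 - j)) div t \<le> slice_shape t j \<nu> i" for i
    using assms(2) unfolding slice_shape_def by (intro div_le_mono) (auto simp: le_fun_def)
  moreover have "slice_shape t j \<nu> i \<le> (t * \<beta> i + (t - 1 - j)) div t" for i
    using assms(3) unfolding slice_shape_def by (intro div_le_mono) (auto simp: le_fun_def)
  ultimately show "\<alpha> \<le> slice_shape t j \<nu>" "slice_shape t j \<nu> \<le> \<beta>"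
    unfolding multiple by (auto simp: le_fun_def)
qed

lemma slice_SSYT:
  assumes "j < t" "T \<in> SSYT \<nu>"
  shows "slice t j \<nu> T \<in> SSYT (slice_shape t j \<nu>)"
  using assms in_diagram_slice_shape[OF assms(1), of _ _ \<nu>]
  unfolding SSYT_def by (auto simp: slice_def)

lemma content_slices:
  assumes "t > 0"
  shows "tableau_content \<nu> T i = (\<Sum>j<t. tableau_content (slice_shape t j \<nu>) (slice t j \<nu> T) i)"
proof -
  define A where "A j = {c \<in> diagram (slice_shape t j \<nu>). slice t j \<nu> T c = i}" for j
  have A: "(r, c) \<in> A j \<longleftrightarrow> (r, t * c + j) \<in> diagram \<nu> \<and> T (r, t * c + j) = i" if "j < t" for r c j
    using in_diagram_slice_shape[OF that, of r c \<nu>] by (auto simp: A_def slice_def)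
  have "bij_betw (\<lambda>(j, r, c). (r, t * c + j)) (SIGMA j:{..<t}. A j) {c \<in> diagram \<nu>. T c = i}"
  proof (rule bij_betw_byWitness[where f' = "\<lambda>(r, c). (c mod t, r, c div t)"])
    show "\<forall>a\<in>SIGMA j:{..<t}. A j.
        (case case a of (j, r, c) \<Rightarrow> (r, t * c + j) of (r, c) \<Rightarrow> (c mod t, r, c div t)) = a"
      by auto
    show "\<forall>a'\<in>{c \<in> diagram \<nu>. T c = i}.
        (case case a' of (r, c) \<Rightarrow> (c mod t, r, c div t) of (j, r, c) \<Rightarrow> (r, t * c + j)) = a'"
      by auto
    show "(\<lambda>(j, r, c). (r, t * c + j)) ` (SIGMA j:{..<t}. A j) \<subseteq> {c \<in> diagram \<nu>. T c = i}"
      using A by auto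
    show "(\<lambda>(r, c). (c mod t, r, c div t)) ` {c \<in> diagram \<nu>. T c = i} \<subseteq> (SIGMA j:{..<t}. A j)"
      using A assms by auto
  qed
  then have "tableau_content \<nu> T i = card (SIGMA j:{..<t}. A j)"
    unfolding tableau_content_def by (simp add: bij_betw_same_card)
  also have "\<dots> = (\<Sum>j<t. card (A j))"
    by (rule card_SigmaI) (auto simp: A_def finite_diagram)
  finally show ?thesis
    by (simp add: A_def tableau_content_def)
qed

text \<open>
  This is the integer decomposition property in terms of exponent vectors: write the point as the
  content of a tableau and cut the tableau into its \<open>t\<close> slices.
\<close>

lemma scaled_lattice_point_decomposes:
  fixes p :: "'m::{finite,linorder} \<Rightarrow> nat"
  assumes "is_partition \<alpha>" "is_partition \<beta>" "\<alpha> \<le> \<beta>" "t > 0"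
    and "vec_of p \<in> subset_sum_polytope (\<lambda>i. t * \<alpha> i) (\<lambda>i. t * \<beta> i)"
  obtains q :: "nat \<Rightarrow> 'm \<Rightarrow> nat" where "\<And>j. j < t \<Longrightarrow> vec_of (q j) \<in> subset_sum_polytope \<alpha> \<beta>"
    "\<And>i. p i = (\<Sum>j<t. q j i)"
proof -
  have "is_partition (\<lambda>i. t * \<alpha> i)" "is_partition (\<lambda>i. t * \<beta> i)" "(\<lambda>i. t * \<alpha> i) \<le> (\<lambda>i. t * \<beta> i)"
    using assms(1-3) by (auto simp: is_partition_def le_fun_def)
  then obtain \<nu> T where \<nu>: "greedy (\<lambda>i. t * \<alpha> i) (\<lambda>i. t * \<beta> i) \<nu>" and T: "T \<in> SSYT \<nu>" "p = tableau_content \<nu> T"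
    using greedy_tableau_of_lattice_point assms(5) by metis
  show ?thesis
  proof (rule that)
    show "p i = (\<Sum>j<t. tableau_content (slice_shape t j \<nu>) (slice t j \<nu> T) i)" for i
      unfolding T(2) by (rule content_slices[OF assms(4)])
    show "vec_of (tableau_content (slice_shape t j \<nu>) (slice t j \<nu> T)) \<in> subset_sum_polytope \<alpha> \<beta>"
      if "j < t" for j
      using \<nu> T(1) that
      by (intro content_in_subset_sum_polytope is_partition_slice_shape slice_SSYT
          slice_shape_between) (auto simp: greedy_def)
  qed
qed

section \<open>Saturation and integer decomposition\<close>

lemma vec_of_in_int_lattice: "vec_of a \<in> int_lattice"
  by (simp add: int_lattice_def vec_of_def)

lemma int_lattice_subset_sum_polytope:
  fixes x :: "real ^ 'm::{finite,linorder}"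
  assumes "x \<in> subset_sum_polytope \<alpha> \<beta>" "x \<in> int_lattice"
  obtains a where "x = vec_of a"
proof (rule that)
  have "0 \<le> x $ i" for i
  proof -
    have "real (tail_sum \<alpha> (CARD('m) - card {i})) \<le> (\<Sum>j\<in>{i}. x $ j)"
      using assms(1) unfolding subset_sum_polytope_def by blast
    then show ?thesis
      by (simp add: order_trans[OF of_nat_0_le_iff])
  qed
  moreover have "\<exists>k. x $ i = of_int k" for i
    using assms(2) by (auto simp: int_lattice_def elim!: Ints_cases)
  ultimately have "x $ i = real (nat \<lfloor>x $ i\<rfloor>)" for i
    by (metis floor_of_int of_int_0_le_iff of_nat_nat)
  then show "x = vec_of (\<lambda>i. nat \<lfloor>x $ i\<rfloor>)"
    by (simp add: vec_of_def vec_eq_iff)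
qed

lemma SNP_IDP_of_subset_sum_support:
  fixes f :: "'m::{finite,linorder} mpoly"
  assumes "is_partition \<alpha>" "is_partition \<beta>" "\<alpha> \<le> \<beta>"
    and Supp: "Supp f = subset_sum_polytope \<alpha> \<beta> \<inter> int_lattice"
  shows "SNP f" "IDP (Newton f)"
proof -
  have Newton: "Newton f \<subseteq> subset_sum_polytope \<alpha> \<beta>"
    unfolding Newton_def using Supp by (intro hull_minimal convex_subset_sum_polytope) auto
  have Supp_Newton: "Supp f \<subseteq> Newton f"
    unfolding Newton_def by (rule hull_subset)
  show "SNP f"
    unfolding SNP_def using Newton Supp_Newton Supp by blast
  have "finite (Supp f)"
    by (simp add: Supp_def)
  then have "polytope (Newton f)"
    unfolding Newton_def polytope_def by blast
  moreover have "v \<in> int_lattice" if "v extreme_point_of Newton f" for v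
    using extreme_point_of_convex_hull that Supp unfolding Newton_def by blast
  ultimately have "lattice_polytope (Newton f)"
    by (simp add: lattice_polytope_def)
  moreover have "\<exists>v :: nat \<Rightarrow> real ^ 'm::{finite,linorder}. (\<forall>k\<in>{1..t}. v k \<in> Newton f \<inter> int_lattice) \<and> p = (\<Sum>k=1..t. v k)"
    if t: "t > 0" and p: "p \<in> (\<lambda>v. real t *\<^sub>R v) ` Newton f \<inter> int_lattice" for t p
  proof -
    have pQ: "p \<in> subset_sum_polytope (\<lambda>i. t * \<alpha> i) (\<lambda>i. t * \<beta> i)"
      using p Newton scaleR_in_subset_sum_polytope by blast
    obtain a where a: "p = vec_of a"
      using int_lattice_subset_sum_polytope pQ p by blast
    obtain q where q: "\<And>j. j < t \<Longrightarrow> vec_of (q j) \<in> subset_sum_polytope \<alpha> \<beta>"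
      "\<And>i. a i = (\<Sum>j<t. q j i)"
      using scaled_lattice_point_decomposes[OF assms(1-3) t] pQ a by blast
    have "p = (\<Sum>j<t. vec_of (q j))"
      by (simp add: a vec_eq_iff vec_of_def q(2))
    also have "\<dots> = (\<Sum>k=1..t. vec_of (q (k - 1)))"
      by (rule sum.reindex_bij_witness[of _ "\<lambda>k. k - 1" Suc]) auto
    finally have "p = (\<Sum>k=1..t. vec_of (q (k - 1)))" .
    moreover have "vec_of (q (k - 1)) \<in> Newton f \<inter> int_lattice" if "k \<in> {1..t}" for k
      using q(1)[of "k - 1"] that Supp Supp_Newton vec_of_in_int_lattice by auto
    ultimately show ?thesis by (intro exI[of _ "\<lambda>k. vec_of (q (k - 1))"]) auto
  qed
  ultimately show "IDP (Newton f)"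
    unfolding IDP_def by blast
qed

section \<open>Supports of combinations of Schur polynomials\<close>

lemma var_power: "var i ^ n = Poly_Mapping.single (Poly_Mapping.single i n) 1"
  by (induction n) (simp_all add: var_def mult_single flip: single_add)

lemma prod_var_power:
  "(\<Prod>i\<in>A. var i ^ a i) = Poly_Mapping.single (\<Sum>i\<in>A. Poly_Mapping.single i (a i)) 1"
  by (induction A rule: infinite_finite_induct) (simp_all add: var_power mult_single)

lemma lookup_prod_var_power:
  fixes b :: "'m::finite \<Rightarrow>\<^sub>0 nat"
  shows "Poly_Mapping.lookup (\<Prod>i\<in>UNIV. var i ^ a i) b = (if a = Poly_Mapping.lookup b then 1 else 0)"
proof -
  have "Poly_Mapping.lookup (\<Sum>i\<in>UNIV. Poly_Mapping.single i (a i)) = a"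
    by (simp add: fun_eq_iff lookup_sum lookup_single when_def)
  then have "(\<Sum>i\<in>UNIV. Poly_Mapping.single i (a i)) = b \<longleftrightarrow> a = Poly_Mapping.lookup b"
    by (metis poly_mapping_eqI)
  then show ?thesis
    by (simp add: prod_var_power lookup_single when_def)
qed

lemma lookup_schur:
  "Poly_Mapping.lookup (schur \<mu>) b = of_nat (card {T \<in> SSYT \<mu>. tableau_content \<mu> T = Poly_Mapping.lookup b})"
proof -
  have "Poly_Mapping.lookup (schur \<mu>) b
      = (\<Sum>T\<in>SSYT \<mu>. if tableau_content \<mu> T = Poly_Mapping.lookup b then 1 else 0)"
    unfolding schur_def lookup_sum tableau_content_def[symmetric] lookup_prod_var_power
    by (simp add: tableau_content_def[abs_def])
  then show ?thesis
    by (simp add: sum.If_cases finite_SSYT Int_def)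
qed

lemma lookup_const_mult: "Poly_Mapping.lookup (const c * p) b = c * Poly_Mapping.lookup p b"
  by (simp add: const_def mult_map_scale_conv_mult[symmetric] Poly_Mapping.map.rep_eq when_def)

lemma lookup_schur_sum:
  "Poly_Mapping.lookup (\<Sum>\<mu>\<in>M. const (c \<mu>) * schur \<mu>) b = (\<Sum>\<mu>\<in>M. c \<mu> * Poly_Mapping.lookup (schur \<mu>) b)"
  by (simp add: lookup_sum lookup_const_mult)

lemma in_keys_schur:
  "b \<in> Poly_Mapping.keys (schur \<mu>) \<longleftrightarrow> Poly_Mapping.lookup b \<in> tableau_content \<mu> ` SSYT \<mu>"
  by (auto simp: in_keys_iff lookup_schur finite_SSYT image_iff) metis

lemma lookup_schur_eq_0:
  assumes "psize (Poly_Mapping.lookup b) \<noteq> psize \<mu>"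
  shows "Poly_Mapping.lookup (schur \<mu>) b = 0"
proof (rule ccontr)
  assume "Poly_Mapping.lookup (schur \<mu>) b \<noteq> 0"
  then obtain T where "Poly_Mapping.lookup b = tableau_content \<mu> T"
    using in_keys_schur[of b \<mu>] by (auto simp: in_keys_iff)
  then show False
    using assms by (simp add: psize_content)
qed

text \<open>
  Brackets are homogeneous of different degrees, so no monomial cancels between two of them.
\<close>

lemma keys_schur_comb:
  "Poly_Mapping.keys (schur_comb C) = (\<Union>d\<in>bracket_sizes C. Poly_Mapping.keys (bracket C d))"
proof -
  have homogeneous: "Poly_Mapping.lookup (bracket C d) b
      = (if d = psize (Poly_Mapping.lookup b) then Poly_Mapping.lookup (schur_comb C) b else 0)" for d b
  proof (cases "d = psize (Poly_Mapping.lookup b)")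
    case True
    have "Poly_Mapping.lookup (schur_comb C) b = Poly_Mapping.lookup (bracket C d) b"
      unfolding schur_comb_def bracket_def lookup_schur_sum
    proof (rule sum.mono_neutral_right)
      show "\<forall>\<mu>\<in>Poly_Mapping.keys C - bracket_parts C d.
          Poly_Mapping.lookup C \<mu> * Poly_Mapping.lookup (schur \<mu>) b = 0"
      proof
        fix \<mu> assume "\<mu> \<in> Poly_Mapping.keys C - bracket_parts C d"
        then have "psize (Poly_Mapping.lookup b) \<noteq> psize \<mu>"
          using True by (auto simp: bracket_parts_def)
        then show "Poly_Mapping.lookup C \<mu> * Poly_Mapping.lookup (schur \<mu>) b = 0"
          by (simp add: lookup_schur_eq_0)
      qed
    qed (auto simp: bracket_parts_def)
    with True show ?thesis by simp
  next
    case False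
    have "Poly_Mapping.lookup (bracket C d) b = 0"
      unfolding bracket_def lookup_schur_sum
      by (rule sum.neutral) (use False in \<open>auto simp: bracket_parts_def lookup_schur_eq_0\<close>)
    with False show ?thesis by simp
  qed
  have "psize (Poly_Mapping.lookup b) \<in> bracket_sizes C" if "b \<in> Poly_Mapping.keys (schur_comb C)" for b
  proof (rule ccontr)
    assume "psize (Poly_Mapping.lookup b) \<notin> bracket_sizes C"
    then have "bracket_parts C (psize (Poly_Mapping.lookup b)) = {}"
      by (auto simp: bracket_parts_def bracket_sizes_def image_iff)
    then have "bracket C (psize (Poly_Mapping.lookup b)) = 0"
      by (simp add: bracket_def)
    then have "Poly_Mapping.lookup (bracket C (psize (Poly_Mapping.lookup b))) b = 0" by simp
    then show False
      using that by (simp add: homogeneous in_keys_iff)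
  qed
  then show ?thesis
    by (auto simp: in_keys_iff homogeneous split: if_splits)
qed

lemma Supp_alt: "Supp f = (\<lambda>b. vec_of (Poly_Mapping.lookup b)) ` Poly_Mapping.keys f"
  by (simp add: Supp_def vec_of_def)

lemma Supp_schur: "Supp (schur \<mu>) = vec_of ` tableau_content \<mu> ` SSYT \<mu>"
proof -
  have "Poly_Mapping.lookup ` Poly_Mapping.keys (schur \<mu>) = tableau_content \<mu> ` SSYT \<mu>"
  proof
    show "tableau_content \<mu> ` SSYT \<mu> \<subseteq> Poly_Mapping.lookup ` Poly_Mapping.keys (schur \<mu>)"
    proof
      fix a assume a: "a \<in> tableau_content \<mu> ` SSYT \<mu>"
      have "a = Poly_Mapping.lookup (Abs_poly_mapping a)" by simp
      moreover from this a have "Abs_poly_mapping a \<in> Poly_Mapping.keys (schur \<mu>)"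
        by (simp add: in_keys_schur)
      ultimately show "a \<in> Poly_Mapping.lookup ` Poly_Mapping.keys (schur \<mu>)" by (rule image_eqI)
    qed
  qed (use in_keys_schur in blast)
  then show ?thesis
    by (metis Supp_alt image_image)
qed

lemma Supp_schur_comb:
  assumes "cond_a C"
  shows "Supp (schur_comb C) = (\<Union>\<mu>\<in>Poly_Mapping.keys C. Supp (schur \<mu>))"
proof -
  have "Supp (schur_comb C) = (\<Union>d\<in>bracket_sizes C. Supp (bracket C d))"
    unfolding Supp_alt keys_schur_comb by blast
  also have "\<dots> = (\<Union>d\<in>bracket_sizes C. \<Union>\<mu>\<in>bracket_parts C d. Supp (schur \<mu>))"
    using assms by (simp add: cond_a_def)
  also have "\<dots> = (\<Union>\<mu>\<in>Poly_Mapping.keys C. Supp (schur \<mu>))"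
    by (auto simp: bracket_sizes_def bracket_parts_def)
  finally show ?thesis .
qed

text \<open>
  The coefficients of Schur polynomials count tableaux, so in a combination with positive weights
  nothing cancels; the common factor \<open>s\<close> carries the sign.
\<close>

lemma keys_positive_schur_sum:
  fixes M :: "('m::{finite,linorder} \<Rightarrow> nat) set"
  assumes "finite M" "\<And>\<mu>. \<mu> \<in> M \<Longrightarrow> c \<mu> > (0::real)" "s \<noteq> (0::complex)"
  shows "Poly_Mapping.keys (\<Sum>\<mu>\<in>M. const (s * of_real (c \<mu>)) * schur \<mu>)
    = (\<Union>\<mu>\<in>M. Poly_Mapping.keys (schur \<mu>))"
proof (rule set_eqI)
  fix b :: "'m \<Rightarrow>\<^sub>0 nat"
  let ?K = "\<lambda>\<mu>. card {T \<in> SSYT \<mu>. tableau_content \<mu> T = Poly_Mapping.lookup b}"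
  have "Poly_Mapping.lookup (\<Sum>\<mu>\<in>M. const (s * of_real (c \<mu>)) * schur \<mu>) b
      = s * of_real (\<Sum>\<mu>\<in>M. c \<mu> * real (?K \<mu>))"
    by (simp add: lookup_schur_sum lookup_schur sum_distrib_left mult.assoc)
  moreover have "(\<Sum>\<mu>\<in>M. c \<mu> * real (?K \<mu>)) = 0 \<longleftrightarrow> (\<forall>\<mu>\<in>M. c \<mu> * real (?K \<mu>) = 0)"
    using assms(1,2) by (intro sum_nonneg_eq_0_iff) (auto simp: less_imp_le)
  moreover have "c \<mu> \<noteq> 0" if "\<mu> \<in> M" for \<mu>
    using assms(2)[OF that] by simp
  ultimately show "b \<in> Poly_Mapping.keys (\<Sum>\<mu>\<in>M. const (s * of_real (c \<mu>)) * schur \<mu>)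
      \<longleftrightarrow> b \<in> (\<Union>\<mu>\<in>M. Poly_Mapping.keys (schur \<mu>))"
    using assms(3) by (auto simp: in_keys_iff lookup_schur simp del: of_real_sum of_real_mult)
qed

lemma cond_a'_imp_cond_a:
  assumes "cond_a' C"
  shows "cond_a C"
  unfolding cond_a_def
proof
  fix d assume d: "d \<in> bracket_sizes C"
  obtain s :: complex and c :: "('a \<Rightarrow> nat) \<Rightarrow> real" where s: "s \<noteq> 0"
    and c: "\<And>\<mu>. \<mu> \<in> bracket_parts C d \<Longrightarrow> c \<mu> > 0 \<and> Poly_Mapping.lookup C \<mu> = s * of_real (c \<mu>)"
  proof -
    consider "\<forall>\<mu>\<in>bracket_parts C d. \<exists>x::real. x > 0 \<and> Poly_Mapping.lookup C \<mu> = of_real x"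
      | "\<forall>\<mu>\<in>bracket_parts C d. \<exists>x::real. x < 0 \<and> Poly_Mapping.lookup C \<mu> = of_real x"
      using assms d unfolding cond_a'_def by blast
    then show ?thesis
    proof cases
      case 1
      then show ?thesis
        by (intro that[of 1 "\<lambda>\<mu>. Re (Poly_Mapping.lookup C \<mu>)"]) auto
    next
      case 2
      then show ?thesis
        by (intro that[of "- 1" "\<lambda>\<mu>. - Re (Poly_Mapping.lookup C \<mu>)"]) auto
    qed
  qed
  have "bracket C d = (\<Sum>\<mu>\<in>bracket_parts C d. const (s * of_real (c \<mu>)) * schur \<mu>)"
    unfolding bracket_def by (rule sum.cong) (use c in auto)
  moreover have "finite (bracket_parts C d)"
    by (simp add: bracket_parts_def)
  ultimately have "Poly_Mapping.keys (bracket C d)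
      = (\<Union>\<mu>\<in>bracket_parts C d. Poly_Mapping.keys (schur \<mu>))"
    using keys_positive_schur_sum[of "bracket_parts C d" c s] s c by simp
  then show "Supp (bracket C d) = (\<Union>\<mu>\<in>bracket_parts C d. Supp (schur \<mu>))"
    unfolding Supp_alt by blast
qed

text \<open>
  The northmost chain from \<open>lo\<close> to \<open>hi\<close> passes through every size in between. It consists of greedy
  partitions, and these dominate everything of their size in the interval.
\<close>

lemma cond_b'_imp_cond_b:
  assumes parts: "\<And>\<mu>. \<mu> \<in> Poly_Mapping.keys C \<Longrightarrow> is_partition \<mu>"
    and "cond_b' C"
  shows "cond_b C"
proof -
  obtain lo hi where lohi: "is_partition lo" "is_partition hi" "lo \<le> hi"
    and keys: "\<And>\<mu>. \<mu> \<in> Poly_Mapping.keys C \<longleftrightarrow> is_partition \<mu> \<and> lo \<le> \<mu> \<and> \<mu> \<le> hi"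
    using assms unfolding cond_b'_def by metis
  define l where "l = psize hi - psize lo"
  obtain \<Lambda> where \<Lambda>: "\<Lambda> 0 = lo" "\<And>i. i < l \<Longrightarrow> northmost_step lo hi (\<Lambda> i) (\<Lambda> (Suc i))"
    unfolding l_def using northmost_chain_exists[OF lohi] by blast
  have greedy: "greedy lo hi (\<Lambda> i)" and size: "psize (\<Lambda> i) = psize lo + i" if "i \<le> l" for i
    using greedy_along_chain[where \<Lambda> = \<Lambda>, OF lohi \<Lambda>(1) \<Lambda>(2) that] by blast+
  have le: "psize lo \<le> psize hi" by (rule psize_mono[OF lohi(3)])
  have top: "\<Lambda> l = hi"
    using greedy[of l] size[of l] le by (intro psize_le_imp_eq) (auto simp: greedy_def l_def)
  have in_keys: "\<Lambda> i \<in> Poly_Mapping.keys C" if "i \<le> l" for i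
    using greedy[OF that] by (simp add: keys greedy_def)
  have sizes: "bracket_sizes C = {psize lo..psize lo + l}"
  proof
    show "bracket_sizes C \<subseteq> {psize lo..psize lo + l}"
      using keys psize_mono le by (fastforce simp: bracket_sizes_def l_def)
    show "{psize lo..psize lo + l} \<subseteq> bracket_sizes C"
    proof
      fix d assume "d \<in> {psize lo..psize lo + l}"
      then have "psize (\<Lambda> (d - psize lo)) = d" "\<Lambda> (d - psize lo) \<in> Poly_Mapping.keys C"
        using size in_keys by auto
      then show "d \<in> bracket_sizes C" unfolding bracket_sizes_def by (metis imageI)
    qed
  qed
  have max: "is_max_part C (psize lo + i) (\<Lambda> i)" if "i \<le> l" for i
    unfolding is_max_part_def bracket_parts_def
    using in_keys[OF that] size[OF that] greedy_dominates[OF greedy[OF that]] keys by auto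
  have max_unique: "\<mu> = \<nu>" if "is_max_part C d \<mu>" "is_max_part C d \<nu>" for d \<mu> \<nu>
    using that by (auto simp: is_max_part_def intro: dominates_antisym)
  have at_size: "\<exists>i\<le>l. d = psize lo + i" if "d \<in> bracket_sizes C" for d
    using that sizes by (intro exI[of _ "d - psize lo"]) auto
  show ?thesis
    unfolding cond_b_def
  proof (intro conjI exI ballI)
    show "\<exists>!\<mu>. is_max_part C d \<mu>" if "d \<in> bracket_sizes C" for d
      using at_size[OF that] max max_unique by blast
    show "card (bracket_sizes C) = l + 1" by (simp add: sizes)
    show "{\<mu>. \<exists>d\<in>bracket_sizes C. is_max_part C d \<mu>} = \<Lambda> ` {0..l}"
    proof (intro set_eqI iffI)
      fix \<mu> assume "\<mu> \<in> {\<mu>. \<exists>d\<in>bracket_sizes C. is_max_part C d \<mu>}"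
      then obtain i where "i \<le> l" "is_max_part C (psize lo + i) \<mu>"
        using at_size by blast
      then show "\<mu> \<in> \<Lambda> ` {0..l}"
        using max_unique[OF max] by (metis atLeast0AtMost atMost_iff image_eqI)
    next
      fix \<mu> assume "\<mu> \<in> \<Lambda> ` {0..l}"
      then obtain i where "i \<le> l" "\<mu> = \<Lambda> i" by auto
      moreover from this have "psize lo + i \<in> bracket_sizes C" by (simp add: sizes)
      ultimately show "\<mu> \<in> {\<mu>. \<exists>d\<in>bracket_sizes C. is_max_part C d \<mu>}"
        using max by blast
    qed
    fix i assume i: "i \<in> {1..l}"
    then have step: "northmost_step lo hi (\<Lambda> (i - 1)) (\<Lambda> i)"
      using \<Lambda>(2)[of "i - 1"] by auto
    then show "northmost_step lo hi (\<Lambda> (i - 1)) (\<Lambda> i)" .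
    from step show "\<Lambda> (i - 1) < \<Lambda> i"
      unfolding northmost_step_def by (metis less_add_box order_refl)
  qed (use lohi \<Lambda>(1) top in auto)
qed

text \<open>
  A partition \<open>\<mu>\<close> that appears in \<open>F\<close> may leave the interval from \<open>\<alpha>\<close> to \<open>\<beta>\<close>, but it is dominated by a
  member \<open>\<nu>\<close> of the chain, and the bounds on the contents for \<open>\<mu>\<close> imply those for \<open>\<nu>\<close>. Conversely a
  lattice point is a content of a greedy shape, and by \<open>greedy_unique\<close> this shape is in the chain.
\<close>

lemma Supp_good:
  fixes C :: "'m::{finite,linorder} schur_coeffs"
  assumes parts: "\<And>\<mu>. \<mu> \<in> Poly_Mapping.keys C \<Longrightarrow> is_partition \<mu>"
    and "good C"
  obtains \<alpha> \<beta> :: "'m \<Rightarrow> nat" where "is_partition \<alpha>" "is_partition \<beta>" "\<alpha> \<le> \<beta>"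
    "Supp (schur_comb C) = subset_sum_polytope \<alpha> \<beta> \<inter> int_lattice"
proof -
  have "cond_a C" "cond_b C" using assms(2) by (auto simp: good_def)
  from \<open>cond_b C\<close> have ex_max: "\<exists>\<mu>. is_max_part C d \<mu>" if "d \<in> bracket_sizes C" for d
    using that unfolding cond_b_def by (meson ex1_implies_ex)
  obtain \<alpha> \<beta> l and \<Lambda> :: "nat \<Rightarrow> 'm \<Rightarrow> nat" where chain:
    "is_partition \<alpha> \<and> is_partition \<beta> \<and> \<alpha> \<le> \<beta> \<and> card (bracket_sizes C) = l + 1 \<and>
     {\<mu>. \<exists>d\<in>bracket_sizes C. is_max_part C d \<mu>} = \<Lambda> ` {0..l} \<and> \<Lambda> 0 = \<alpha> \<and> \<Lambda> l = \<beta> \<and>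
     (\<forall>i\<in>{1..l}. \<Lambda> (i - 1) < \<Lambda> i \<and> northmost_step \<alpha> \<beta> (\<Lambda> (i - 1)) (\<Lambda> i))"
    using conjunct2[OF \<open>cond_b C\<close>[unfolded cond_b_def]] by (elim exE) (rule that)
  from chain have \<alpha>\<beta>: "is_partition \<alpha>" "is_partition \<beta>" "\<alpha> \<le> \<beta>"
    and maxima: "{\<mu>. \<exists>d\<in>bracket_sizes C. is_max_part C d \<mu>} = \<Lambda> ` {0..l}"
    and ends: "\<Lambda> 0 = \<alpha>" "\<Lambda> l = \<beta>"
    by blast+
  from chain have steps: "northmost_step \<alpha> \<beta> (\<Lambda> (i - 1)) (\<Lambda> i)" if "i \<in> {1..l}" for i
    using that by (elim conjE) (drule bspec, assumption, erule conjunct2)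
  have step: "northmost_step \<alpha> \<beta> (\<Lambda> i) (\<Lambda> (Suc i))" if "i < l" for i
    using steps[of "Suc i"] that by simp
  have greedy: "greedy \<alpha> \<beta> (\<Lambda> i)" and size: "psize (\<Lambda> i) = psize \<alpha> + i" if "i \<le> l" for i
    using greedy_along_chain[where \<Lambda> = \<Lambda>, OF \<alpha>\<beta> ends(1) step that] by blast+
  have Supp: "Supp (schur_comb C) = (\<Union>\<mu>\<in>Poly_Mapping.keys C. vec_of ` tableau_content \<mu> ` SSYT \<mu>)"
    by (simp add: Supp_schur_comb[OF \<open>cond_a C\<close>] Supp_schur)
  have "Supp (schur_comb C) \<subseteq> subset_sum_polytope \<alpha> \<beta>"
  proof
    fix x assume "x \<in> Supp (schur_comb C)"
    then obtain \<mu> T where \<mu>: "\<mu> \<in> Poly_Mapping.keys C" and T: "T \<in> SSYT \<mu>" "x = vec_of (tableau_content \<mu> T)"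
      unfolding Supp by blast
    have d: "psize \<mu> \<in> bracket_sizes C" "\<mu> \<in> bracket_parts C (psize \<mu>)"
      using \<mu> by (auto simp: bracket_sizes_def bracket_parts_def)
    then obtain \<nu> where \<nu>: "is_max_part C (psize \<mu>) \<nu>"
      using ex_max by blast
    then have "\<nu> \<unrhd> \<mu>" using d by (simp add: is_max_part_def)
    have "\<nu> \<in> \<Lambda> ` {0..l}" unfolding maxima[symmetric] using d(1) \<nu> by blast
    then have "greedy \<alpha> \<beta> \<nu>" using greedy by auto
    then have "\<alpha> \<le> \<nu>" "\<nu> \<le> \<beta>" by (auto simp: greedy_def)
    moreover have "sum (tableau_content \<mu> T) S \<le> top_sum \<nu> (card S)" for S
      using sum_content_le_top_sum[OF parts[OF \<mu>] T(1)] \<open>\<nu> \<unrhd> \<mu>\<close>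
      unfolding dominates_iff_top_sum by (meson order_trans)
    moreover have "psize (tableau_content \<mu> T) = psize \<nu>"
      using \<open>\<nu> \<unrhd> \<mu>\<close> by (simp add: psize_content dominates_iff_top_sum)
    ultimately show "x \<in> subset_sum_polytope \<alpha> \<beta>"
      unfolding T(2) by (intro dominated_in_subset_sum_polytope[of _ \<nu>])
  qed
  moreover have "Supp (schur_comb C) \<subseteq> int_lattice"
    unfolding Supp using vec_of_in_int_lattice by blast
  moreover have "x \<in> Supp (schur_comb C)" if x: "x \<in> subset_sum_polytope \<alpha> \<beta>" "x \<in> int_lattice" for x
  proof -
    obtain a where a: "x = vec_of a"
      using int_lattice_subset_sum_polytope[OF x] by blast
    obtain \<nu> T where \<nu>: "greedy \<alpha> \<beta> \<nu>" and T: "T \<in> SSYT \<nu>" "a = tableau_content \<nu> T"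
      using greedy_tableau_of_lattice_point[OF \<alpha>\<beta>] x(1) a by metis
    define i where "i = psize \<nu> - psize \<alpha>"
    have "psize \<alpha> \<le> psize \<nu>" "psize \<nu> \<le> psize \<beta>"
      using \<nu> psize_mono by (auto simp: greedy_def)
    then have i: "i \<le> l" "psize \<nu> = psize \<alpha> + i"
      using size[of l] ends(2) by (auto simp: i_def)
    then have "\<nu> = \<Lambda> i"
      using greedy_unique[OF \<nu> greedy[OF i(1)]] size[OF i(1)] by simp
    moreover have "\<Lambda> i \<in> \<Lambda> ` {0..l}" using i(1) by simp
    ultimately obtain d where "is_max_part C d \<nu>"
      unfolding maxima[symmetric] by blast
    then have "\<nu> \<in> Poly_Mapping.keys C" by (simp add: is_max_part_def bracket_parts_def)
    then show ?thesis
      unfolding Supp using T a by blast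
  qed
  ultimately have "Supp (schur_comb C) = subset_sum_polytope \<alpha> \<beta> \<inter> int_lattice" by blast
  with \<alpha>\<beta> show ?thesis by (rule that)
qed

theorem corollary4p3:
  fixes C :: "'m::{finite,linorder} schur_coeffs" and F :: "'m mpoly"
  assumes parts: "\<And>\<mu>. \<mu> \<in> Poly_Mapping.keys C \<Longrightarrow> is_partition \<mu>"
    and F: "F = schur_comb C"
    and cond: "(cond_a' C \<and> cond_b C) \<or> (cond_a C \<and> cond_b' C) \<or> (cond_a' C \<and> cond_b' C)"
  shows "good C \<and> SNP F \<and> IDP (Newton F)"
proof -
  have good: "good C"
    unfolding good_def using cond cond_a'_imp_cond_a cond_b'_imp_cond_b[OF parts] by blast
  show ?thesis
    using Supp_good[OF parts good] SNP_IDP_of_subset_sum_support good F by metis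
qed

end
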